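(* Let $\alpha\neq 0$, $0\le\theta<1$, $T>0$, $K\ge 1$, $L\ge 1$. If $\theta\neq 0$, suppose additionally that $L\le T^{1/2}$. Let $(a_k)$ and $(b_l)$ be arbitrary sequences of complex numbers with $|a_k|\le A$ for all $k\sim K$ and $|b_l|\le B$ for all $l\sim L$. Then $$\int_0^T\Big|\sum_{k\sim K}a_k k^{it}\Big|^2\Big|\sum_{l\sim L}b_l(l+\theta)^{i\alpha t}\Big|^2\,dt\ll A^2B^2(T+KL)KL\log^3(2KLT),$$ where the implied constant depends only on $\alpha$. If $\theta=0$, then $\log^3(2KLT)$ may be replaced by $\log^2(2KLT)$.
   Context: The notation $k\sim K$ means $K<k\le 2K$ (with $k$ an integer), and similarly for $l\sim L$.
   Formalization: The factor log(2KLT) is replaced by max(1, log(2KLT)) in both bounds, since for θ=0 and small T (e.g. K=L=1, T=1/4 or T=1/2) the logarithm is negative or zero and the stated bounds fail. *)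

theory Defs
  imports "HOL-Analysis.Analysis"
begin

definition dyadic :: "real \<Rightarrow> nat set" where
  "dyadic K = {k::nat. K < real k \<and> real k \<le> 2 * K}"

definition cpow_it :: "real \<Rightarrow> real \<Rightarrow> complex" where
  "cpow_it x t = exp (\<i> * complex_of_real (t * ln x))"

end

theory Submission
  imports Defs
begin

text \<open>
  Multiplying out, the integrand is the squared modulus of an exponential sum with frequencies
  \<open>ln k + \<alpha> ln (l + \<theta>)\<close>, so the integral is at most a constant times \<open>A\<^sup>2 B\<^sup>2 T\<close> times the number of
  quadruples with \<open>\<bar>ln (k/k') + \<alpha> ln ((l + \<theta>)/(l' + \<theta>))\<bar> \<le> 1/T\<close>.

  Sort the pairs \<open>(k, k')\<close> by their gcd \<open>g\<close>. The reduced pairs \<open>(r, s)\<close> lie in \<open>(R, 2R]\<close> with \<open>R = K/g\<close>, and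
  their logarithmic ratios are separated by \<open>1/(4R\<^sup>2)\<close>. For fixed \<open>(r, s)\<close>, the pairs \<open>(l, l')\<close> that occur lie
  within \<open>O(L/T)\<close> of a line of slope \<open>x = (s/r)\<^bsup>1/\<alpha>\<^esup>\<close>. If two of them have second coordinates at
  distance \<open>v\<close>, then \<open>x\<close> is within \<open>O(L/(vT))\<close> of a fraction with denominator \<open>v\<close>, and separation of the
  ratios bounds the number of such \<open>(r, s)\<close>. This gives \<open>O(RL + R\<^sup>2L\<^sup>2(1 + ln L)/T)\<close> quadruples for each \<open>g\<close>,
  uniformly in \<open>\<theta>\<close>; summation over \<open>g\<close> costs one more logarithm in the first term only, so that a
  single logarithm suffices in total.
\<close>

section \<open>Mean squares of exponential sums\<close>

lemma has_integral_cis_int: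
  "((\<lambda>t. cis (real_of_int m * t)) has_integral (if m = 0 then 2 * pi else 0)) {0..2 * pi}"
proof (cases "m = 0")
  case True
  then show ?thesis using has_integral_const_real[of "1::complex" 0 "2 * pi"] by (simp add: scaleR_conv_of_real)
next
  case False
  define F where "F t = cis (real_of_int m * t) / (\<i> * of_int m)" for t
  have "((\<lambda>t. cis (real_of_int m * t)) has_integral F (2 * pi) - F 0) {0..2 * pi}"
  proof (rule fundamental_theorem_of_calculus)
    fix t :: real
    have "((\<lambda>z. exp (\<i> * of_int m * z) / (\<i> * of_int m)) has_field_derivative exp (\<i> * of_int m * of_real t)) (at (of_real t))"
      using False by (auto intro!: derivative_eq_intros)
    then have "((\<lambda>t. exp (\<i> * of_int m * of_real t) / (\<i> * of_int m)) has_vector_derivative exp (\<i> * of_int m * of_real t)) (at t within {0..2 * pi})"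
      by (rule has_vector_derivative_real_field)
    then show "(F has_vector_derivative cis (real_of_int m * t)) (at t within {0..2 * pi})"
      unfolding F_def by (simp add: cis_conv_exp mult.assoc)
  qed simp
  moreover have "cis (real_of_int m * (2 * pi)) = 1"
    using cis_multiple_2pi[of "of_int m"] by (simp add: mult_ac)
  ultimately show ?thesis using False by (simp add: F_def)
qed

text \<open>Parseval over a full period: after squaring out, integration kills every off-diagonal
  term, because distinct elements of \<open>J\<close> are distinct integer frequencies.\<close>

lemma has_integral_norm_trig_poly:
  fixes d :: "int \<Rightarrow> complex"
  assumes "finite J"
  shows "((\<lambda>t. (norm (\<Sum>j\<in>J. d j * cis (of_int j * t)))\<^sup>2) has_integral 2 * pi * (\<Sum>j\<in>J. (norm (d j))\<^sup>2)) {0..2 * pi}"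
proof -
  have eq: "complex_of_real ((norm (\<Sum>j\<in>J. d j * cis (of_int j * t)))\<^sup>2) =
      (\<Sum>j\<in>J. \<Sum>k\<in>J. d j * cnj (d k) * cis (of_int (j - k) * t))" for t
    unfolding complex_norm_square cnj_sum sum_product complex_cnj_mult cis_cnj
    by (intro sum.cong refl) (simp add: cis_mult mult_ac left_diff_distrib right_diff_distrib)
  have "((\<lambda>t. \<Sum>j\<in>J. \<Sum>k\<in>J. d j * cnj (d k) * cis (of_int (j - k) * t)) has_integral
      (\<Sum>j\<in>J. \<Sum>k\<in>J. d j * cnj (d k) * (if j - k = 0 then 2 * pi else 0))) {0..2 * pi}"
    by (intro has_integral_sum assms has_integral_mult_right has_integral_cis_int)
  moreover have "(\<Sum>j\<in>J. \<Sum>k\<in>J. d j * cnj (d k) * (if j - k = 0 then 2 * pi else 0)) =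
      complex_of_real (2 * pi * (\<Sum>j\<in>J. (norm (d j))\<^sup>2))"
  proof -
    have "(\<Sum>k\<in>J. d j * cnj (d k) * (if j - k = 0 then 2 * pi else 0)) = complex_of_real (2 * pi * (norm (d j))\<^sup>2)"
      if "j \<in> J" for j
    proof -
      have "(\<Sum>k\<in>J. d j * cnj (d k) * (if j - k = 0 then 2 * pi else 0)) =
          (\<Sum>k\<in>J. if j = k then d j * cnj (d k) * (2 * pi) else 0)"
        by (intro sum.cong) auto
      also have "\<dots> = d j * cnj (d j) * (2 * pi)" using that assms by simp
      also have "\<dots> = complex_of_real (2 * pi * (norm (d j))\<^sup>2)"
        by (simp add: complex_norm_square[symmetric] flip: of_real_mult of_real_power)
      finally show ?thesis .
    qed
    then show ?thesis by (simp add: sum_distrib_left)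
  qed
  ultimately have "((\<lambda>t. complex_of_real ((norm (\<Sum>j\<in>J. d j * cis (of_int j * t)))\<^sup>2)) has_integral
      complex_of_real (2 * pi * (\<Sum>j\<in>J. (norm (d j))\<^sup>2))) {0..2 * pi}"
    unfolding eq by simp
  from has_integral_Re[OF this] show ?thesis by simp
qed

lemma sum_inverse_fact_le: "(\<Sum>p\<le>P. 1 / fact p :: real) \<le> exp 1"
proof -
  have "(\<Sum>p\<le>P. 1 / fact p :: real) \<le> (\<Sum>p. 1 / fact p)"
    using summable_exp[of "1::real"] by (intro sum_le_suminf) (auto simp: field_simps)
  then show ?thesis by (simp add: exp_def divide_inverse)
qed

text \<open>Cauchy-Schwarz with each weight \<open>1 / fact p\<close> split evenly between the two
  factors. The weights sum to at most \<open>exp 1\<close>, so the constant does not depend on the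
  truncation point \<open>P\<close>.\<close>

lemma norm_sq_weighted_sum_le:
  fixes z :: "nat \<Rightarrow> complex"
  shows "(norm (\<Sum>p\<le>P. z p / fact p))\<^sup>2 \<le> exp 1 * (\<Sum>p\<le>P. (norm (z p))\<^sup>2 / fact p)"
proof -
  have "norm (z p / fact p) = (1 / sqrt (fact p)) * (norm (z p) / sqrt (fact p))" for p
  proof -
    have "norm (z p / fact p) = norm (z p) / fact p" by (simp add: norm_divide)
    also have "\<dots> = (1 / sqrt (fact p)) * (norm (z p) / sqrt (fact p))"
      unfolding times_divide_times_eq by simp
    finally show ?thesis .
  qed
  then have "norm (\<Sum>p\<le>P. z p / fact p) \<le> (\<Sum>p\<le>P. (1 / sqrt (fact p)) * (norm (z p) / sqrt (fact p)))"
    using norm_sum[of "\<lambda>p. z p / fact p" "{..P}"] by simp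
  then have "(norm (\<Sum>p\<le>P. z p / fact p))\<^sup>2 \<le> (\<Sum>p\<le>P. (1 / sqrt (fact p)) * (norm (z p) / sqrt (fact p)))\<^sup>2"
    by (intro power_mono) auto
  also have "\<dots> \<le> (\<Sum>p\<le>P. (1 / sqrt (fact p))\<^sup>2) * (\<Sum>p\<le>P. (norm (z p) / sqrt (fact p))\<^sup>2)"
    by (rule Cauchy_Schwarz_ineq_sum)
  also have "\<dots> = (\<Sum>p\<le>P. 1 / fact p) * (\<Sum>p\<le>P. (norm (z p))\<^sup>2 / fact p)"
    by (simp add: power_divide)
  also have "\<dots> \<le> exp 1 * (\<Sum>p\<le>P. (norm (z p))\<^sup>2 / fact p)"
    by (intro mult_right_mono sum_inverse_fact_le sum_nonneg) auto
  finally show ?thesis .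
qed

text \<open>After the integer parts of the frequencies are split off, the fractional parts are removed by
  expanding the exponential into its Taylor series; each Taylor coefficient is a trigonometric
  polynomial with integer frequencies, to which orthogonality applies.\<close>

lemma exp_sum_mean_square_unit:
  fixes c :: "'a \<Rightarrow> complex" and \<mu> :: "'a \<Rightarrow> real"
  assumes "finite I"
  shows "integral {0..1} (\<lambda>t. (norm (\<Sum>n\<in>I. c n * cis (\<mu> n * t)))\<^sup>2) \<le>
    4 * pi * (exp 1)\<^sup>2 * (\<Sum>m\<in>I. \<Sum>n\<in>{n \<in> I. \<lfloor>\<mu> n\<rfloor> = \<lfloor>\<mu> m\<rfloor>}. norm (c m) * norm (c n))"
proof -
  define j where "j n = \<lfloor>\<mu> n\<rfloor>" for n
  define \<nu> where "\<nu> n = frac (\<mu> n)" for n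
  define S where "S t = (\<Sum>n\<in>I. c n * cis (\<mu> n * t))" for t
  \<comment> \<open>Expanding the fractional part of each exponential in powers of \<open>t\<close>
    writes \<open>S t\<close> as the series of \<open>t ^ p * F p t / fact p\<close>.
    \<open>SP P\<close> is its partial sum up to degree \<open>P\<close>, and \<open>r P\<close>
    will bound the remainder on the unit interval.\<close>
  define F where "F p t = (\<Sum>n\<in>I. c n * (\<i> * \<nu> n) ^ p * cis (j n * t))" for p :: nat and t :: real
  define SP where "SP P t = (\<Sum>p\<le>P. (of_real t ^ p * F p t) / fact p)" for P :: nat and t :: real
  define r where "r P = (\<Sum>n\<in>I. norm (c n)) * (1 / fact P)" for P :: nat
  define B where "B = (\<Sum>k\<in>j ` I. (\<Sum>n\<in>{n \<in> I. j n = k}. norm (c n))\<^sup>2)"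
  have \<nu>: "0 \<le> \<nu> n" "\<nu> n \<le> 1" "\<mu> n = j n + \<nu> n" for n
    using frac_lt_1[of "\<mu> n"] by (simp_all add: \<nu>_def j_def frac_def)
  have contF: "continuous_on A (F p)" for p A
    unfolding F_def by (intro continuous_intros)
  have contS: "continuous_on A S" for A unfolding S_def by (intro continuous_intros)
  have B_eq: "B = (\<Sum>m\<in>I. \<Sum>n\<in>{n \<in> I. j n = j m}. norm (c m) * norm (c n))"
  proof -
    have "B = (\<Sum>k\<in>j ` I. \<Sum>m\<in>{m \<in> I. j m = k}. \<Sum>n\<in>{n \<in> I. j n = j m}. norm (c m) * norm (c n))"
      unfolding B_def power2_eq_square sum_product by (intro sum.cong refl) auto
    also have "\<dots> = (\<Sum>m\<in>I. \<Sum>n\<in>{n \<in> I. j n = j m}. norm (c m) * norm (c n))"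
      using assms by (intro sum.group) auto
    finally show ?thesis .
  qed
  have B0: "0 \<le> B" unfolding B_def by (intro sum_nonneg) auto
  have intF: "integral {0..1} (\<lambda>t. (norm (F p t))\<^sup>2) \<le> 2 * pi * B" for p
  proof -
    define d where "d k = (\<Sum>n\<in>{n \<in> I. j n = k}. c n * (\<i> * \<nu> n) ^ p)" for k
    have F_eq: "F p t = (\<Sum>k\<in>j ` I. d k * cis (of_int k * t))" for t
    proof -
      have "(\<Sum>k\<in>j ` I. d k * cis (of_int k * t)) =
          (\<Sum>k\<in>j ` I. \<Sum>n\<in>{n \<in> I. j n = k}. c n * (\<i> * \<nu> n) ^ p * cis (j n * t))"
        unfolding d_def sum_distrib_right by (intro sum.cong refl) auto
      also have "\<dots> = F p t" unfolding F_def using assms by (intro sum.group) auto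
      finally show ?thesis by simp
    qed
    have hi: "((\<lambda>t. (norm (F p t))\<^sup>2) has_integral 2 * pi * (\<Sum>k\<in>j ` I. (norm (d k))\<^sup>2)) {0..2 * pi}"
      unfolding F_eq by (rule has_integral_norm_trig_poly) (use assms in simp)
    \<comment> \<open>The integrand is nonnegative, so the unit interval may be enlarged to a full
      period, where orthogonality is exact.\<close>
    have "integral {0..1} (\<lambda>t. (norm (F p t))\<^sup>2) \<le> integral {0..2 * pi} (\<lambda>t. (norm (F p t))\<^sup>2)"
      using pi_gt3 by (intro integral_subset_le integrable_continuous_real continuous_intros contF) auto
    also have "\<dots> = 2 * pi * (\<Sum>k\<in>j ` I. (norm (d k))\<^sup>2)" using hi by (rule integral_unique)
    also have "\<dots> \<le> 2 * pi * B"
    proof -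
      have "norm (d k) \<le> (\<Sum>n\<in>{n \<in> I. j n = k}. norm (c n))" for k
        unfolding d_def
      proof (rule sum_norm_le)
        fix n
        show "norm (c n * (\<i> * \<nu> n) ^ p) \<le> norm (c n)"
          using power_le_one[of "\<nu> n" p] \<nu>[of n]
          by (simp add: norm_mult norm_power mult_left_le)
      qed
      then show ?thesis unfolding B_def by (intro mult_left_mono sum_mono power_mono) auto
    qed
    finally show ?thesis .
  qed
  have rem: "norm (S t - SP P t) \<le> r P" if t: "0 \<le> t" "t \<le> 1" for t P
  proof -
    have "SP P t = (\<Sum>n\<in>I. c n * cis (j n * t) * (\<Sum>p\<le>P. (\<i> * (\<nu> n * t)) ^ p / fact p))"
      unfolding SP_def F_def sum_distrib_left sum_distrib_right sum_divide_distrib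
      by (subst sum.swap, intro sum.cong refl) (simp add: power_mult_distrib mult_ac)
    moreover have "S t = (\<Sum>n\<in>I. c n * cis (j n * t) * exp (\<i> * (\<nu> n * t)))"
    proof -
      have "cis (\<mu> n * t) = cis (j n * t) * exp (\<i> * (\<nu> n * t))" for n
        by (subst \<nu>(3)) (simp add: cis_conv_exp exp_add distrib_right distrib_left)
      then show ?thesis unfolding S_def by (simp add: mult.assoc)
    qed
    ultimately have "S t - SP P t = (\<Sum>n\<in>I. c n * cis (j n * t) *
        (exp (\<i> * (\<nu> n * t)) - (\<Sum>p\<le>P. (\<i> * (\<nu> n * t)) ^ p / fact p)))"
      by (simp add: right_diff_distrib sum_subtractf)
    also have "norm \<dots> \<le> (\<Sum>n\<in>I. norm (c n) * (1 / fact P))"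
    proof (rule sum_norm_le)
      fix n
      \<comment> \<open>The argument is purely imaginary of modulus at most 1, so the exponential
        factor and the power in Taylor's remainder are both at most 1.\<close>
      have "norm (exp (\<i> * (\<nu> n * t)) - (\<Sum>p\<le>P. (\<i> * (\<nu> n * t)) ^ p / fact p))
          \<le> exp \<bar>Re (\<i> * (\<nu> n * t))\<bar> * norm (\<i> * (\<nu> n * t)) ^ Suc P / fact P"
        using Taylor_exp[of "\<i> * (\<nu> n * t)" P] by simp
      also have "\<dots> \<le> 1 / fact P"
      proof (rule divide_right_mono)
        have "(\<nu> n * t) ^ Suc P \<le> 1"
          using \<nu>[of n] t by (intro power_le_one mult_le_one) auto
        then show "exp \<bar>Re (\<i> * (\<nu> n * t))\<bar> * norm (\<i> * (\<nu> n * t)) ^ Suc P \<le> 1"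
          using \<nu>[of n] t by (simp add: norm_mult)
      qed simp
      finally show "norm (c n * cis (j n * t) * (exp (\<i> * (\<nu> n * t)) - (\<Sum>p\<le>P. (\<i> * (\<nu> n * t)) ^ p / fact p)))
          \<le> norm (c n) * (1 / fact P)"
        unfolding norm_mult norm_cis by (intro mult_mono) auto
    qed
    finally show ?thesis by (simp add: r_def sum_divide_distrib)
  qed
  have bound: "integral {0..1} (\<lambda>t. (norm (S t))\<^sup>2) \<le> 4 * pi * (exp 1)\<^sup>2 * B + 2 * (r P)\<^sup>2" for P
  proof -
    have pw: "(norm (S t))\<^sup>2 \<le> 2 * exp 1 * (\<Sum>p\<le>P. (norm (F p t))\<^sup>2 / fact p) + 2 * (r P)\<^sup>2"
      if "t \<in> {0..1}" for t
    proof -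
      have "norm (S t) \<le> norm (SP P t) + r P"
        using norm_triangle_ineq[of "SP P t" "S t - SP P t"] rem[of t P] that by simp
      then have "(norm (S t))\<^sup>2 \<le> (norm (SP P t) + r P)\<^sup>2" by (intro power_mono) auto
      also have "\<dots> \<le> 2 * (norm (SP P t))\<^sup>2 + 2 * (r P)\<^sup>2"
        using sum_squares_bound[of "norm (SP P t)" "r P"] by (simp add: power2_sum)
      also have "(norm (SP P t))\<^sup>2 \<le> exp 1 * (\<Sum>p\<le>P. (norm (of_real t ^ p * F p t))\<^sup>2 / fact p)"
        unfolding SP_def by (rule norm_sq_weighted_sum_le)
      also have "\<dots> \<le> exp 1 * (\<Sum>p\<le>P. (norm (F p t))\<^sup>2 / fact p)"
      proof (intro mult_left_mono sum_mono divide_right_mono power_mono)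
        fix p show "norm (of_real t ^ p * F p t) \<le> norm (F p t)"
          using power_le_one[of t p] that by (simp add: norm_mult norm_power mult_left_le_one_le)
      qed auto
      finally show ?thesis by simp
    qed
    have "integral {0..1} (\<lambda>t. (norm (S t))\<^sup>2) \<le>
        integral {0..1} (\<lambda>t. 2 * exp 1 * (\<Sum>p\<le>P. (norm (F p t))\<^sup>2 / fact p) + 2 * (r P)\<^sup>2)"
      using pw by (intro integral_le integrable_continuous_real continuous_intros contF contS) auto
    also have "\<dots> = 2 * exp 1 * (\<Sum>p\<le>P. integral {0..1} (\<lambda>t. (norm (F p t))\<^sup>2) / fact p) + 2 * (r P)\<^sup>2"
      by (subst integral_add, (intro integrable_continuous_real continuous_intros contF, simp)+)
         (simp add: integral_sum integrable_continuous_real continuous_intros contF)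
    also have "\<dots> \<le> 2 * exp 1 * (\<Sum>p\<le>P. 2 * pi * B * (1 / fact p)) + 2 * (r P)\<^sup>2"
      using intF by (intro add_right_mono mult_left_mono sum_mono) (auto intro: divide_right_mono)
    also have "\<dots> = 4 * pi * exp 1 * B * (\<Sum>p\<le>P. 1 / fact p) + 2 * (r P)\<^sup>2"
      by (simp add: sum_distrib_left mult_ac)
    also have "\<dots> \<le> 4 * pi * exp 1 * B * exp 1 + 2 * (r P)\<^sup>2"
      using B0 by (intro add_right_mono mult_left_mono sum_inverse_fact_le) auto
    finally show ?thesis by (simp add: power2_eq_square mult_ac)
  qed
  \<comment> \<open>Only the remainder depends on \<open>P\<close>, and it vanishes in the limit.
    The constant collects 2 from squaring a sum of two terms, \<open>2 * pi\<close> from the period,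
    one \<open>exp 1\<close> from Cauchy-Schwarz and one from summing
    \<open>1 / fact p\<close>.\<close>
  have "(\<lambda>P. 1 / fact P :: real) \<longlonglongrightarrow> 0"
    using summable_LIMSEQ_zero[OF summable_exp[of "1::real"]] by (simp add: divide_inverse)
  then have "(\<lambda>P. 4 * pi * (exp 1)\<^sup>2 * B + 2 * (r P)\<^sup>2) \<longlonglongrightarrow> 4 * pi * (exp 1)\<^sup>2 * B + 2 * ((\<Sum>n\<in>I. norm (c n)) * 0)\<^sup>2"
    unfolding r_def by (intro tendsto_intros)
  then have "integral {0..1} (\<lambda>t. (norm (S t))\<^sup>2) \<le> 4 * pi * (exp 1)\<^sup>2 * B"
    using bound by (intro LIMSEQ_le_const) auto
  then show ?thesis unfolding B_eq S_def j_def .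
qed

text \<open>Substituting \<open>T * t\<close> for \<open>t\<close> multiplies the frequencies by
  \<open>T\<close>. Scaled frequencies with equal integer parts come from frequencies at distance at
  most \<open>1 / T\<close>, which turns the double sum of the unit interval into a pair
  count.\<close>

lemma exp_sum_mean_square:
  fixes c :: "'a \<Rightarrow> complex" and \<phi> :: "'a \<Rightarrow> real"
  assumes "finite I" "T > 0" "\<And>n. n \<in> I \<Longrightarrow> norm (c n) \<le> M"
  shows "integral {0..T} (\<lambda>t. (norm (\<Sum>n\<in>I. c n * cis (\<phi> n * t)))\<^sup>2) \<le>
    4 * pi * (exp 1)\<^sup>2 * T * M\<^sup>2 * real (card {(m, n). m \<in> I \<and> n \<in> I \<and> \<bar>\<phi> m - \<phi> n\<bar> \<le> 1 / T})"
proof -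
  define f where "f t = (norm (\<Sum>n\<in>I. c n * cis (\<phi> n * t)))\<^sup>2" for t
  have "f integrable_on {0..T}"
    unfolding f_def by (intro integrable_continuous_real continuous_intros)
  then have "(f has_integral integral {0..T} f) (cbox 0 T)" by (simp add: integrable_integral)
  from has_integral_affinity'[OF this assms(2), of 0]
  have "((\<lambda>t. f (T * t)) has_integral integral {0..T} f / T) {0..1}"
    using assms(2) by (simp add: divide_inverse mult.commute)
  then have "integral {0..1} (\<lambda>t. f (T * t)) = integral {0..T} f / T"
    by (rule integral_unique)
  then have "integral {0..T} f = T * integral {0..1} (\<lambda>t. f (T * t))" using assms(2) by simp
  also have "\<dots> = T * integral {0..1} (\<lambda>t. (norm (\<Sum>n\<in>I. c n * cis (T * \<phi> n * t)))\<^sup>2)"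
    by (simp add: f_def mult_ac)
  also have "\<dots> \<le> T * (4 * pi * (exp 1)\<^sup>2 *
      (\<Sum>m\<in>I. \<Sum>n\<in>{n \<in> I. \<lfloor>T * \<phi> n\<rfloor> = \<lfloor>T * \<phi> m\<rfloor>}. norm (c m) * norm (c n)))"
    using assms by (intro mult_left_mono exp_sum_mean_square_unit) auto
  also have "(\<Sum>m\<in>I. \<Sum>n\<in>{n \<in> I. \<lfloor>T * \<phi> n\<rfloor> = \<lfloor>T * \<phi> m\<rfloor>}. norm (c m) * norm (c n)) \<le>
      (\<Sum>m\<in>I. \<Sum>n\<in>{n \<in> I. \<bar>\<phi> m - \<phi> n\<bar> \<le> 1 / T}. M * M)"
  proof (intro sum_mono order_trans[OF sum_mono sum_mono2])
    fix m
    show "{n \<in> I. \<lfloor>T * \<phi> n\<rfloor> = \<lfloor>T * \<phi> m\<rfloor>} \<subseteq> {n \<in> I. \<bar>\<phi> m - \<phi> n\<bar> \<le> 1 / T}"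
    proof clarify
      fix n assume "\<lfloor>T * \<phi> n\<rfloor> = \<lfloor>T * \<phi> m\<rfloor>"
      then have "\<bar>T * \<phi> m - T * \<phi> n\<bar> \<le> 1" by linarith
      then have "T * \<bar>\<phi> m - \<phi> n\<bar> \<le> 1"
        using assms(2) by (simp add: abs_mult flip: right_diff_distrib)
      then show "\<bar>\<phi> m - \<phi> n\<bar> \<le> 1 / T" using assms(2) by (simp add: field_simps)
    qed
  qed (use assms norm_ge_zero in \<open>auto intro!: mult_mono intro: order_trans[OF norm_ge_zero]\<close>)
  also have "\<dots> = M\<^sup>2 * real (card (Sigma I (\<lambda>m. {n \<in> I. \<bar>\<phi> m - \<phi> n\<bar> \<le> 1 / T})))"
    using assms(1) by (simp add: card_SigmaI sum_distrib_left power2_eq_square mult_ac)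
  also have "Sigma I (\<lambda>m. {n \<in> I. \<bar>\<phi> m - \<phi> n\<bar> \<le> 1 / T}) = {(m, n). m \<in> I \<and> n \<in> I \<and> \<bar>\<phi> m - \<phi> n\<bar> \<le> 1 / T}"
    by auto
  finally show ?thesis using assms(2) by (simp add: f_def mult_ac)
qed

section \<open>Separation of logarithms of fractions\<close>

lemma dyadic_subset: "dyadic K \<subseteq> {1..nat \<lfloor>2 * K\<rfloor>}" if "K \<ge> 0"
  using that by (auto simp: dyadic_def le_nat_floor)

lemma finite_dyadic: "finite (dyadic K)"
proof (rule finite_subset)
  show "dyadic K \<subseteq> {..nat \<lfloor>2 * K\<rfloor>}"
    by (auto simp: dyadic_def le_nat_floor)
qed simp

lemma card_dyadic_le: "real (card (dyadic K)) \<le> 2 * K" if "K \<ge> 0"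
proof -
  have "card (dyadic K) \<le> card {1..nat \<lfloor>2 * K\<rfloor>}"
    by (rule card_mono[OF _ dyadic_subset[OF that]]) simp
  then show ?thesis using that by simp linarith
qed

text \<open>Cut the interval into half-open cells of length \<open>\<Delta>\<close> starting at
  \<open>a\<close>. No cell receives two elements, and the summand 1 accounts for the last, partial
  cell.\<close>

lemma card_separated_le:
  fixes f :: "'a \<Rightarrow> real"
  assumes "\<Delta> > 0" and "S \<subseteq> {p. a \<le> f p \<and> f p \<le> a + w}" and "w \<ge> 0"
    and sep: "\<And>p q. p \<in> S \<Longrightarrow> q \<in> S \<Longrightarrow> p \<noteq> q \<Longrightarrow> \<Delta> \<le> \<bar>f p - f q\<bar>"
  shows "real (card S) \<le> 1 + w / \<Delta>"
proof -
  define g where "g p = \<lfloor>(f p - a) / \<Delta>\<rfloor>" for p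
  have inj: "inj_on g S"
  proof (rule inj_onI, rule ccontr)
    fix p q assume pq: "p \<in> S" "q \<in> S" "g p = g q" "p \<noteq> q"
    have "\<bar>(f p - a) / \<Delta> - (f q - a) / \<Delta>\<bar> < 1"
      using pq(3) unfolding g_def by linarith
    moreover have "(f p - a) / \<Delta> - (f q - a) / \<Delta> = (f p - f q) / \<Delta>"
      by (simp add: diff_divide_distrib)
    ultimately have "\<bar>f p - f q\<bar> < \<Delta>"
      using assms(1) by (simp add: abs_divide)
    with sep[OF pq(1,2,4)] show False by simp
  qed
  have sub: "g ` S \<subseteq> {0..\<lfloor>w / \<Delta>\<rfloor>}"
  proof
    fix z assume "z \<in> g ` S"
    then obtain p where p: "p \<in> S" "z = g p" by auto
    then have "0 \<le> f p - a" "f p - a \<le> w" using assms(2) by auto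
    then show "z \<in> {0..\<lfloor>w / \<Delta>\<rfloor>}" unfolding p(2) g_def
      using assms(1) by (auto intro!: floor_mono divide_right_mono)
  qed
  have "card S = card (g ` S)" using inj by (simp add: card_image)
  also have "\<dots> \<le> card {0..\<lfloor>w / \<Delta>\<rfloor>}" by (rule card_mono[OF _ sub]) simp
  finally have "real (card S) \<le> real (nat (\<lfloor>w / \<Delta>\<rfloor> + 1))" by simp
  also have "\<dots> \<le> 1 + w / \<Delta>"
  proof -
    have "0 \<le> w / \<Delta>" using assms by simp
    then show ?thesis by linarith
  qed
  finally show "real (card S) \<le> 1 + w / \<Delta>" .
qed

text \<open>The mean value bound for a function whose derivative is at least \<open>1 / M\<close> up
  to \<open>M\<close>. It and the companion upper bound both come from
  \<open>ln z \<le> z - 1\<close>.\<close>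

lemma abs_ln_diff_ge:
  fixes x y M :: real
  assumes "0 < x" "0 < y" "x \<le> M" "y \<le> M"
  shows "\<bar>x - y\<bar> / M \<le> \<bar>ln x - ln y\<bar>"
proof -
  have *: "(v - u) / M \<le> ln v - ln u" if "0 < u" "u \<le> v" "v \<le> M" for u v :: real
  proof -
    have "(v - u) / M \<le> (v - u) / v" using that by (intro divide_left_mono) auto
    also have "\<dots> = 1 - u / v" using that by (simp add: field_simps)
    also have "\<dots> \<le> - ln (u / v)" using ln_le_minus_one[of "u / v"] that by simp
    also have "\<dots> = ln v - ln u" using that by (simp add: ln_div)
    finally show ?thesis .
  qed
  show ?thesis
  proof (cases "x \<le> y")
    case True
    then show ?thesis using *[of x y] assms by (smt (verit))
  next
    case False
    then show ?thesis using *[of y x] assms by (smt (verit))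
  qed
qed

lemma abs_ln_diff_le:
  fixes x y m :: real
  assumes "0 < m" "m \<le> x" "m \<le> y"
  shows "\<bar>ln x - ln y\<bar> \<le> \<bar>x - y\<bar> / m"
proof -
  have *: "ln v - ln u \<le> (v - u) / m" if "m \<le> u" "u \<le> v" for u v :: real
  proof -
    have "ln v - ln u = ln (v / u)" using that assms(1) by (simp add: ln_div)
    also have "\<dots> \<le> v / u - 1" using that assms(1) by (intro ln_le_minus_one) auto
    also have "\<dots> = (v - u) / u" using that assms(1) by (simp add: field_simps)
    also have "\<dots> \<le> (v - u) / m" using that assms(1) by (intro divide_left_mono) auto
    finally show ?thesis .
  qed
  show ?thesis
  proof (cases "x \<le> y")
    case True
    moreover have "ln x \<le> ln y" using True assms by simp
    ultimately show ?thesis using *[of x y] assms by simp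
  next
    case False
    moreover have "ln y \<le> ln x" using False assms by simp
    ultimately show ?thesis using *[of y x] assms by simp
  qed
qed

section \<open>Reduced pairs and the spacing of their logarithmic ratios\<close>

text \<open>The parameter \<open>R\<close> is real because it will be \<open>K / g\<close> for a gcd
  \<open>g\<close>; it can drop below 1.\<close>

definition coprime_pairs :: "real \<Rightarrow> (nat \<times> nat) set" where
  "coprime_pairs R = {(r, s). r \<in> dyadic R \<and> s \<in> dyadic R \<and> coprime r s}"

definition log_ratio :: "nat \<times> nat \<Rightarrow> real" where
  "log_ratio p = ln (real (fst p)) - ln (real (snd p))"

lemma coprime_pairs_subset: "coprime_pairs R \<subseteq> dyadic R \<times> dyadic R"
  by (auto simp: coprime_pairs_def)

lemma finite_coprime_pairs: "finite (coprime_pairs R)"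
  by (rule finite_subset[OF coprime_pairs_subset]) (simp add: finite_dyadic)

lemma card_coprime_pairs_le: "real (card (coprime_pairs R)) \<le> 4 * R\<^sup>2" if "R \<ge> 0"
proof -
  have "card (coprime_pairs R) \<le> card (dyadic R \<times> dyadic R)"
    by (intro card_mono coprime_pairs_subset) (simp add: finite_dyadic)
  then have "real (card (coprime_pairs R)) \<le> real (card (dyadic R)) * real (card (dyadic R))"
    by (simp add: card_cartesian_product flip: of_nat_mult)
  also have "\<dots> \<le> (2 * R) * (2 * R)"
    using that by (intro mult_mono card_dyadic_le) auto
  finally show ?thesis by (simp add: power2_eq_square)
qed

text \<open>Distinct reduced fractions have a nonzero integer cross difference
  \<open>r * s' - r' * s\<close>. Both products are at most \<open>4 * R\<^sup>2\<close>, so the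
  lower bound for differences of logarithms applies.\<close>

lemma log_ratio_separated:
  assumes "p \<in> coprime_pairs R" "q \<in> coprime_pairs R" "p \<noteq> q" "R > 0"
  shows "1 / (4 * R\<^sup>2) \<le> \<bar>log_ratio p - log_ratio q\<bar>"
proof -
  obtain r s r' s' where pq: "p = (r, s)" "q = (r', s')" by fastforce
  have b: "R < r" "r \<le> 2 * R" "R < s" "s \<le> 2 * R" "coprime r s"
      "R < r'" "r' \<le> 2 * R" "R < s'" "s' \<le> 2 * R" "coprime r' s'"
    using assms unfolding pq coprime_pairs_def dyadic_def by auto
  have pos: "0 < real r" "0 < real s" "0 < real r'" "0 < real s'" using b assms by linarith+
  have ne: "r * s' \<noteq> r' * s"
    using coprime_crossproduct_nat[OF b(5,10)] assms(3) pq by (auto simp: mult.commute)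
  have "1 / (4 * R\<^sup>2) \<le> \<bar>real (r * s') - real (r' * s)\<bar> / (4 * R\<^sup>2)"
  proof (intro divide_right_mono)
    show "1 \<le> \<bar>real (r * s') - real (r' * s)\<bar>" using ne by linarith
  qed simp
  also have "\<dots> \<le> \<bar>ln (real (r * s')) - ln (real (r' * s))\<bar>"
  proof (rule abs_ln_diff_ge)
    show "real (r * s') \<le> 4 * R\<^sup>2"
      using mult_mono[of r "2*R" s' "2*R"] b pos by (simp add: power2_eq_square)
    show "real (r' * s) \<le> 4 * R\<^sup>2"
      using mult_mono[of r' "2*R" s "2*R"] b pos by (simp add: power2_eq_square)
  qed (use pos in auto)
  also have "\<dots> = \<bar>log_ratio p - log_ratio q\<bar>"
    using pos by (simp add: pq log_ratio_def ln_mult)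
  finally show ?thesis .
qed

lemma card_log_ratio_near:
  assumes "R > 0" "\<eta> \<ge> 0"
  shows "real (card {p \<in> coprime_pairs R. \<bar>log_ratio p - y\<bar> \<le> \<eta>}) \<le> 1 + 8 * R\<^sup>2 * \<eta>"
proof -
  have "real (card {p \<in> coprime_pairs R. \<bar>log_ratio p - y\<bar> \<le> \<eta>}) \<le> 1 + 2 * \<eta> / (1 / (4 * R\<^sup>2))"
    by (rule card_separated_le[where f = log_ratio and a = "y - \<eta>"])
       (use assms in \<open>auto intro: log_ratio_separated\<close>)
  then show ?thesis by (simp add: mult_ac)
qed

text \<open>This keeps the slope \<open>exp (- log_ratio p / \<alpha>)\<close> between two positive
  constants that depend only on \<open>\<alpha>\<close>.\<close>

lemma log_ratio_le_1:
  assumes "p \<in> coprime_pairs R" "R > 0" shows "\<bar>log_ratio p\<bar> \<le> 1"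
proof -
  obtain r s where p: "p = (r, s)" by fastforce
  have b: "R < r" "r \<le> 2 * R" "R < s" "s \<le> 2 * R"
    using assms unfolding p coprime_pairs_def dyadic_def by auto
  have "\<bar>ln (real r) - ln (real s)\<bar> \<le> \<bar>real r - real s\<bar> / R"
    by (rule abs_ln_diff_le) (use b assms in auto)
  also have "\<dots> \<le> R / R" using b assms by (intro divide_right_mono) auto
  finally show ?thesis using assms by (simp add: p log_ratio_def)
qed

text \<open>The pair with the smallest positive difference works: that difference separates all of
  \<open>S\<close>, which lies in an interval of length \<open>L\<close>.\<close>

lemma exists_small_gap:
  fixes S :: "nat set"
  assumes "S \<subseteq> dyadic L" "L > 0" "card S \<ge> 2"
  obtains a b where "a \<in> S" "b \<in> S" "a < b" "real (card S) \<le> 1 + L / real (b - a)"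
proof -
  have fin: "finite S" using assms finite_dyadic finite_subset by blast
  define D where "D = {v. \<exists>a\<in>S. \<exists>b\<in>S. a < b \<and> v = b - a}"
  have "\<exists>a\<in>S. \<exists>b\<in>S. a \<noteq> b"
    using assms(3) card_le_Suc0_iff_eq[OF fin] by force
  then have "D \<noteq> {}" unfolding D_def by (auto simp: nat_neq_iff)
  then obtain w where "w \<in> D" by blast
  define v where "v = (LEAST v. v \<in> D)"
  have v: "v \<in> D" "\<And>w. w \<in> D \<Longrightarrow> v \<le> w"
    unfolding v_def using \<open>w \<in> D\<close> by (auto intro: LeastI Least_le)
  then obtain a b where ab: "a \<in> S" "b \<in> S" "a < b" "v = b - a"
    unfolding D_def by auto
  have "real (card S) \<le> 1 + L / real v"
  proof (rule card_separated_le[where f = real and a = L])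
    fix p q assume "p \<in> S" "q \<in> S" "p \<noteq> q"
    then have "max p q - min p q \<in> D" unfolding D_def
      by (cases "p < q") (auto simp: max_def min_def nat_neq_iff)
    from v(2)[OF this] show "real v \<le> \<bar>real p - real q\<bar>" by (auto simp: max_def min_def split: if_splits)
  qed (use assms ab in \<open>auto simp: dyadic_def\<close>)
  with ab show ?thesis using that by blast
qed

section \<open>Counting close pairs of ratios\<close>

text \<open>Here \<open>y\<close> stands for the logarithmic ratio of a pair \<open>(k, k')\<close>,
  and the set consists of the pairs \<open>(l, l')\<close> that complete it to a counted quadruple;
  \<open>\<delta>\<close> will be \<open>1 / T\<close>.\<close>

definition near_pairs :: "real \<Rightarrow> real \<Rightarrow> real \<Rightarrow> real \<Rightarrow> real \<Rightarrow> (nat \<times> nat) set" where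
  "near_pairs \<alpha> \<theta> L \<delta> y = {(l, m). l \<in> dyadic L \<and> m \<in> dyadic L \<and>
     \<bar>y + \<alpha> * (ln (real l + \<theta>) - ln (real m + \<theta>))\<bar> \<le> \<delta>}"

lemma near_pairs_subset: "near_pairs \<alpha> \<theta> L \<delta> y \<subseteq> dyadic L \<times> dyadic L"
  by (auto simp: near_pairs_def)

lemma finite_near_pairs: "finite (near_pairs \<alpha> \<theta> L \<delta> y)"
  by (rule finite_subset[OF near_pairs_subset]) (simp add: finite_dyadic)

text \<open>Exponentiating turns close logarithms into closeness to a line. One exponential is
  \<open>l + \<theta> \<le> 3 * L\<close>, and \<open>\<delta> \<le> 1\<close> lets the other exceed
  it by at most a factor \<open>exp (1 / \<bar>\<alpha>\<bar>)\<close>; below that height a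
  difference of logarithms controls the difference itself.\<close>

lemma near_pairs_linear:
  fixes \<alpha> :: real
  assumes "(l, m) \<in> near_pairs \<alpha> \<theta> L \<delta> y" "\<alpha> \<noteq> 0" "0 \<le> \<theta>" "\<theta> \<le> 1" "L \<ge> 1" "\<delta> \<le> 1"
  shows "\<bar>real l + \<theta> - exp (- y / \<alpha>) * (real m + \<theta>)\<bar> \<le> 3 / \<bar>\<alpha>\<bar> * exp (1 / \<bar>\<alpha>\<bar>) * L * \<delta>"
proof -
  define E where "E = exp (1 / \<bar>\<alpha>\<bar>)"
  have E1: "E \<ge> 1" by (simp add: E_def)
  have l: "L < l" "l \<le> 2 * L" "L < m" and near: "\<bar>y + \<alpha> * (ln (real l + \<theta>) - ln (real m + \<theta>))\<bar> \<le> \<delta>"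
    using assms(1) by (auto simp: near_pairs_def dyadic_def)
  define a where "a = ln (real l + \<theta>)"
  define b where "b = - y / \<alpha> + ln (real m + \<theta>)"
  have ea: "exp a = real l + \<theta>" and eb: "exp b = exp (- y / \<alpha>) * (real m + \<theta>)"
    using l assms unfolding a_def b_def exp_add by simp_all
  have "\<alpha> * (a - b) = y + \<alpha> * (ln (real l + \<theta>) - ln (real m + \<theta>))"
    using assms(2) by (simp add: a_def b_def algebra_simps)
  then have "\<bar>\<alpha>\<bar> * \<bar>a - b\<bar> \<le> \<delta>" using near by (metis abs_mult)
  then have ab: "\<bar>a - b\<bar> \<le> \<delta> / \<bar>\<alpha>\<bar>" using assms(2) by (simp add: pos_le_divide_eq mult.commute)
  also have "\<dots> \<le> 1 / \<bar>\<alpha>\<bar>" using assms by (intro divide_right_mono) auto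
  finally have "b \<le> a + 1 / \<bar>\<alpha>\<bar>" by linarith
  then have "exp b \<le> exp (a + 1 / \<bar>\<alpha>\<bar>)" by (simp only: exp_le_cancel_iff)
  then have b_le: "exp b \<le> exp a * E" by (simp add: exp_add E_def)
  have a_le: "exp a \<le> 3 * L" using l assms unfolding ea by linarith
  have "exp a * E \<le> 3 * L * E" using a_le E1 by (intro mult_right_mono) auto
  moreover have "exp a \<le> exp a * E" using E1 by simp
  ultimately have "exp a \<le> 3 * L * E" "exp b \<le> 3 * L * E" using b_le by linarith+
  then have "\<bar>exp a - exp b\<bar> / (3 * L * E) \<le> \<bar>ln (exp a) - ln (exp b)\<bar>"
    by (intro abs_ln_diff_ge) auto
  then have "\<bar>exp a - exp b\<bar> / (3 * L * E) \<le> \<delta> / \<bar>\<alpha>\<bar>" using ab by simp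
  then have "\<bar>exp a - exp b\<bar> \<le> \<delta> / \<bar>\<alpha>\<bar> * (3 * L * E)"
    using pos_divide_le_eq[of "3 * L * E"] assms(5) E1 by simp
  also have "\<dots> = 3 / \<bar>\<alpha>\<bar> * E * L * \<delta>" by simp
  finally show ?thesis unfolding ea eb E_def .
qed

text \<open>For each \<open>m\<close> the integer \<open>l\<close> is confined to an interval of
  length \<open>2 * w\<close>. This is efficient when \<open>L * \<delta>\<close> is bounded
  below.\<close>

lemma card_near_pairs_crude:
  fixes \<alpha> :: real
  assumes "\<alpha> \<noteq> 0" "0 \<le> \<theta>" "\<theta> \<le> 1" "L \<ge> 1" "0 \<le> \<delta>" "\<delta> \<le> 1"
  defines "w \<equiv> 3 / \<bar>\<alpha>\<bar> * exp (1 / \<bar>\<alpha>\<bar>) * L * \<delta>"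
  shows "real (card (near_pairs \<alpha> \<theta> L \<delta> y)) \<le> 2 * L * (1 + 2 * w)"
proof -
  define x where "x = exp (- y / \<alpha>)"
  define F where "F m = {l \<in> dyadic L. \<bar>real l + \<theta> - x * (real m + \<theta>)\<bar> \<le> w}" for m :: nat
  have w0: "0 \<le> w" using assms by (simp add: w_def)
  have finF: "finite (F m)" for m by (simp add: F_def finite_dyadic)
  have cF: "real (card (F m)) \<le> 1 + 2 * w" for m
  proof -
    have "real (card (F m)) \<le> 1 + 2 * w / 1"
      by (rule card_separated_le[where f = real and a = "x * (real m + \<theta>) - \<theta> - w"])
         (use w0 in \<open>auto simp: F_def\<close>)
    then show ?thesis by simp
  qed
  have "card (near_pairs \<alpha> \<theta> L \<delta> y) = card (prod.swap ` near_pairs \<alpha> \<theta> L \<delta> y)"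
    by (simp add: card_image)
  also have "\<dots> \<le> card (Sigma (dyadic L) F)"
  proof (rule card_mono)
    show "prod.swap ` near_pairs \<alpha> \<theta> L \<delta> y \<subseteq> Sigma (dyadic L) F"
      using near_pairs_linear[OF _ assms(1-4,6)] near_pairs_subset
      by (fastforce simp: F_def x_def w_def)
  qed (simp add: finite_dyadic finF)
  also have "\<dots> = (\<Sum>m\<in>dyadic L. card (F m))"
    by (simp add: card_SigmaI finite_dyadic finF)
  finally have "real (card (near_pairs \<alpha> \<theta> L \<delta> y)) \<le> (\<Sum>m\<in>dyadic L. real (card (F m)))"
    by (simp flip: of_nat_sum)
  also have "\<dots> \<le> real (card (dyadic L)) * (1 + 2 * w)"
    using sum_bounded_above[of "dyadic L" "\<lambda>m. real (card (F m))", OF cF] by simp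
  also have "\<dots> \<le> 2 * L * (1 + 2 * w)"
    using card_dyadic_le[of L] assms w0 by (intro mult_right_mono) auto
  finally show ?thesis .
qed

definition below :: "real \<Rightarrow> nat set" where
  "below R = {v. 1 \<le> v \<and> real v < R}"

lemma below_subset: "below R \<subseteq> {1..nat \<lfloor>R\<rfloor>}"
  by (auto simp: below_def le_nat_floor)

lemma finite_below: "finite (below R)"
  by (rule finite_subset[OF below_subset]) simp

text \<open>Subtracting two elements of \<^term>\<open>near_pairs \<alpha> \<theta> L \<delta> y\<close> removes the shift by \<^term>\<open>\<theta>\<close>. Hence two
  elements with nearby second components force a good rational approximation to
  \<^term>\<open>exp (- y / \<alpha>)\<close> with a small denominator.\<close>

lemma card_near_pairs_gap:
  fixes \<alpha> :: real
  assumes "\<alpha> \<noteq> 0" "0 \<le> \<theta>" "\<theta> \<le> 1" "L \<ge> 1" "0 \<le> \<delta>" "\<delta> \<le> 1" "R > 0"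
  defines "\<epsilon> \<equiv> 6 / \<bar>\<alpha>\<bar> * exp (1 / \<bar>\<alpha>\<bar>) * L * \<delta>"
  assumes "\<epsilon> < 1"
  shows "real (card (near_pairs \<alpha> \<theta> L \<delta> y)) \<le> 1 + L / R +
    (\<Sum>v\<in>below R. L / real v * of_bool (\<exists>u::int. \<bar>of_int u - exp (- y / \<alpha>) * real v\<bar> \<le> \<epsilon>))"
    (is "_ \<le> _ + (\<Sum>v\<in>_. ?f v)")
proof -
  define x where "x = exp (- y / \<alpha>)"
  define N where "N = near_pairs \<alpha> \<theta> L \<delta> y"
  have fin: "finite N" by (simp add: N_def finite_near_pairs)
  have diff: "\<bar>real l - real l' - x * (real m - real m')\<bar> \<le> \<epsilon>"
    if "(l, m) \<in> N" "(l', m') \<in> N" for l m l' m'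
  proof -
    have "x * (real m - real m') = x * (real m + \<theta>) - x * (real m' + \<theta>)"
      by (simp add: algebra_simps)
    \<comment> \<open>The constant 6 is twice 3 because the errors of two points add up.\<close>
    moreover have "\<epsilon> = 2 * (3 / \<bar>\<alpha>\<bar> * exp (1 / \<bar>\<alpha>\<bar>) * L * \<delta>)" by (simp add: \<epsilon>_def)
    ultimately show ?thesis
      using near_pairs_linear[OF that(1)[unfolded N_def] assms(1-4,6)]
        near_pairs_linear[OF that(2)[unfolded N_def] assms(1-4,6)]
      unfolding x_def[symmetric] by linarith
  qed
  \<comment> \<open>Points with the same second component have first components at distance at most
    \<open>\<epsilon> < 1\<close>, hence equal, so points may be counted by second
    components.\<close>
  have inj: "inj_on snd N"
  proof (rule inj_onI, clarsimp)
    fix l m l' assume "(l, m) \<in> N" "(l', m) \<in> N"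
    from diff[OF this] assms(9) show "l = l'" by simp
  qed
  have f0: "0 \<le> ?f v" for v using assms by simp
  show ?thesis
  proof (cases "card N \<ge> 2")
    case False
    moreover have "0 \<le> L / R" using assms by simp
    ultimately show ?thesis
      using sum_nonneg[of "below R" ?f, OF f0] unfolding N_def by linarith
  next
    case True
    have N2: "card (snd ` N) \<ge> 2" "snd ` N \<subseteq> dyadic L"
      using True inj by (auto simp: card_image N_def near_pairs_def)
    obtain a b where ab: "a \<in> snd ` N" "b \<in> snd ` N" "a < b"
        and c: "real (card (snd ` N)) \<le> 1 + L / real (b - a)"
    proof (rule exists_small_gap[OF N2(2) _ N2(1)])
      show "L > 0" using assms by simp
    qed
    define v where "v = b - a"
    have v1: "v \<ge> 1" using ab by (simp add: v_def)
    have cN: "real (card N) \<le> 1 + L / real v" using c inj by (simp add: card_image v_def)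
    obtain l l' where l: "(l, a) \<in> N" "(l', b) \<in> N" using ab by auto
    \<comment> \<open>A gap \<open>v\<close> of size at least \<open>R\<close> leaves at most
      \<open>1 + L / R\<close> points. A smaller one makes \<open>x * v\<close> nearly an integer,
      so the summand at \<open>v\<close> alone covers \<open>L / v\<close>.\<close>
    show ?thesis
    proof (cases "real v < R")
      case False
      then have "L / real v \<le> L / R" using assms by (intro divide_left_mono) auto
      then show ?thesis using cN sum_nonneg[of "below R" ?f, OF f0] unfolding N_def by linarith
    next
      case True
      then have v: "v \<in> below R" using v1 by (auto simp: below_def)
      have "\<bar>of_int (int l' - int l) - x * real v\<bar> \<le> \<epsilon>"
        using diff[OF l(2,1)] ab by (simp add: of_nat_diff v_def)
      then have "\<exists>u::int. \<bar>of_int u - exp (- y / \<alpha>) * real v\<bar> \<le> \<epsilon>" unfolding x_def by blast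
      then have "L / real v = ?f v" by simp
      also have "\<dots> \<le> (\<Sum>v\<in>below R. ?f v)"
        by (rule member_le_sum[OF v _ finite_below]) (rule f0)
      finally have "L / real v \<le> (\<Sum>v\<in>below R. ?f v)" .
      moreover have "0 \<le> L / R" using assms by simp
      ultimately show ?thesis using cN unfolding N_def by linarith
    qed
  qed
qed

text \<open>An admissible \<open>p\<close> has a positive integer \<open>u \<le> 2 * E * v\<close>
  for which \<open>log_ratio p\<close> is close to \<open>- \<alpha> * ln (u / v)\<close>.
  Separation of the ratios bounds the number of \<open>p\<close> belonging to each
  \<open>u\<close>.\<close>

lemma card_approximable_le:
  fixes \<alpha> :: real and v :: nat
  assumes "\<alpha> \<noteq> 0" "R > 0" "v \<ge> 1" "0 \<le> \<epsilon>" 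
  defines "E \<equiv> exp (1 / \<bar>\<alpha>\<bar>)"
  assumes "\<epsilon> \<le> 1 / (2 * E)"
  shows "real (card {p \<in> coprime_pairs R. \<exists>u::int. \<bar>of_int u - exp (- log_ratio p / \<alpha>) * real v\<bar> \<le> \<epsilon>})
    \<le> 2 * E * real v + 32 * \<bar>\<alpha>\<bar> * E\<^sup>2 * R\<^sup>2 * \<epsilon>"
proof -
  have E1: "E \<ge> 1" by (simp add: E_def)
  define n where "n = nat \<lfloor>2 * E * real v\<rfloor>"
  \<comment> \<open>Both \<open>u\<close> and \<open>x * v\<close> will be at least
    \<open>v / (2 * E)\<close>, so their logarithms differ by at most \<open>\<epsilon>\<close>
    divided by this; the factor \<open>\<bar>\<alpha>\<bar>\<close> undoes the division in the
    exponent.\<close>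
  define \<eta> where "\<eta> = \<bar>\<alpha>\<bar> * (2 * E * \<epsilon> / real v)"
  have \<eta>0: "0 \<le> \<eta>" using assms E1 by (simp add: \<eta>_def)
  define G where "G u = {p \<in> coprime_pairs R. \<bar>log_ratio p - (- \<alpha> * ln (real u / real v))\<bar> \<le> \<eta>}" for u :: nat
  have sub: "{p \<in> coprime_pairs R. \<exists>u::int. \<bar>of_int u - exp (- log_ratio p / \<alpha>) * real v\<bar> \<le> \<epsilon>}
      \<subseteq> (\<Union>u\<in>{1..n}. G u)"
  proof clarify
    fix r s :: nat and u :: int
    define p where "p = (r, s)"
    define x where "x = exp (- log_ratio p / \<alpha>)"
    assume p: "(r, s) \<in> coprime_pairs R" and u: "\<bar>of_int u - exp (- log_ratio (r, s) / \<alpha>) * real v\<bar> \<le> \<epsilon>"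
    have u: "\<bar>of_int u - x * real v\<bar> \<le> \<epsilon>" using u by (simp add: x_def p_def)
    have "\<bar>- log_ratio p / \<alpha>\<bar> \<le> 1 / \<bar>\<alpha>\<bar>"
      using log_ratio_le_1[OF p assms(2)] assms(1) by (simp add: p_def abs_divide divide_right_mono)
    then have "- (1 / \<bar>\<alpha>\<bar>) \<le> - log_ratio p / \<alpha>" "- log_ratio p / \<alpha> \<le> 1 / \<bar>\<alpha>\<bar>" by linarith+
    then have "exp (- (1 / \<bar>\<alpha>\<bar>)) \<le> x" "x \<le> E" unfolding x_def E_def exp_le_cancel_iff .
    then have x: "1 / E \<le> x" "x \<le> E" by (auto simp: E_def exp_minus inverse_eq_divide)
    have "1 / E * 1 \<le> 1 / E * real v" using assms E1 by (intro mult_left_mono) auto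
    also have "\<dots> \<le> x * real v" using x by (intro mult_right_mono) auto
    finally have xv: "1 / E \<le> x * real v" by simp
    have "1 / E * real v \<le> x * real v" using x by (intro mult_right_mono) auto
    then have xv': "real v / E \<le> x * real v" by simp
    have half: "1 / (2 * E) = (1 / E) / 2" by simp
    have Epos: "0 < 1 / E" using E1 by simp
    \<comment> \<open>By hypothesis \<open>\<epsilon>\<close> is at most half of
      \<open>x * v\<close>, which makes \<open>u\<close> positive and comparable to
      \<open>x * v\<close>.\<close>
    have ge: "x * real v / 2 \<le> of_int u" using u assms(6) xv half by linarith
    have "\<epsilon> \<le> x * real v" using assms(6) half xv Epos by linarith
    then have "of_int u \<le> 2 * (x * real v)" using u by linarith
    also have "\<dots> \<le> 2 * (E * real v)" using x by (intro mult_left_mono mult_right_mono) auto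
    finally have le: "of_int u \<le> 2 * E * real v" by simp
    have upos: "0 < real_of_int u" using ge xv Epos by linarith
    have nu: "real (nat u) = of_int u" using upos by simp
    have nat_u: "nat u \<in> {1..n}" using upos le unfolding n_def by (auto simp: le_nat_floor nu)
    have ln_le: "\<bar>ln (real (nat u)) - ln (x * real v)\<bar> \<le> \<bar>real (nat u) - x * real v\<bar> / (real v / (2 * E))"
    proof (rule abs_ln_diff_le)
      show "real v / (2 * E) \<le> real (nat u)" unfolding nu using ge xv' by (simp add: field_simps)
      have "0 \<le> real v / E" using E1 by simp
      then show "real v / (2 * E) \<le> x * real v" using xv' by simp
    qed (use assms E1 in auto)
    have "\<bar>ln (real (nat u) / real v) - ln x\<bar> \<le> \<epsilon> / (real v / (2 * E))"
    proof -
      have "\<bar>real (nat u) - x * real v\<bar> / (real v / (2 * E)) \<le> \<epsilon> / (real v / (2 * E))"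
        using u E1 assms unfolding nu by (intro divide_right_mono) auto
      moreover have "ln (real (nat u) / real v) - ln x = ln (real (nat u)) - ln (x * real v)"
        using upos assms by (simp add: ln_div ln_mult x_def nu)
      ultimately show ?thesis using ln_le by linarith
    qed
    then have "\<bar>\<alpha>\<bar> * \<bar>ln (real (nat u) / real v) - ln x\<bar> \<le> \<bar>\<alpha>\<bar> * (\<epsilon> / (real v / (2 * E)))"
      by (intro mult_left_mono) auto
    moreover have "\<bar>\<alpha>\<bar> * \<bar>ln (real (nat u) / real v) - ln x\<bar> = \<bar>log_ratio p - (- \<alpha> * ln (real (nat u) / real v))\<bar>"
      unfolding abs_mult[symmetric] x_def using assms(1) by (simp add: algebra_simps)
    ultimately have "(r, s) \<in> G (nat u)" unfolding G_def using p by (simp add: \<eta>_def p_def mult_ac)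
    then show "(r, s) \<in> (\<Union>u\<in>{1..n}. G u)" using nat_u by blast
  qed
  have "card {p \<in> coprime_pairs R. \<exists>u::int. \<bar>of_int u - exp (- log_ratio p / \<alpha>) * real v\<bar> \<le> \<epsilon>}
      \<le> card (\<Union>u\<in>{1..n}. G u)"
    by (rule card_mono[OF _ sub]) (auto simp: G_def finite_coprime_pairs)
  also have "\<dots> \<le> (\<Sum>u\<in>{1..n}. card (G u))" by (rule card_UN_le) simp
  finally have "real (card {p \<in> coprime_pairs R. \<exists>u::int. \<bar>of_int u - exp (- log_ratio p / \<alpha>) * real v\<bar> \<le> \<epsilon>})
      \<le> (\<Sum>u\<in>{1..n}. real (card (G u)))" by (simp flip: of_nat_sum)
  also have "\<dots> \<le> real n * (1 + 8 * R\<^sup>2 * \<eta>)"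
  proof -
    have "real (card (G u)) \<le> 1 + 8 * R\<^sup>2 * \<eta>" for u
      unfolding G_def by (rule card_log_ratio_near[OF assms(2) \<eta>0])
    then show ?thesis using sum_bounded_above[of "{1..n}" "\<lambda>u. real (card (G u))"] by simp
  qed
  also have "\<dots> \<le> 2 * E * real v * (1 + 8 * R\<^sup>2 * \<eta>)"
  proof (rule mult_right_mono)
    have "0 \<le> 2 * E * real v" using E1 by simp
    then show "real n \<le> 2 * E * real v" unfolding n_def by linarith
  qed (use \<eta>0 in auto)
  also have "\<dots> = 2 * E * real v + 32 * \<bar>\<alpha>\<bar> * E\<^sup>2 * R\<^sup>2 * \<epsilon>"
  proof -
    \<comment> \<open>The denominator \<open>v\<close> in \<open>\<eta>\<close> cancels against the
      number of values of \<open>u\<close>, so the second term is free of \<open>v\<close>.\<close>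
    have "real v * \<eta> = \<bar>\<alpha>\<bar> * (2 * E * \<epsilon>)" using assms(3) by (simp add: \<eta>_def)
    moreover have "2 * E * real v * (1 + 8 * R\<^sup>2 * \<eta>) = 2 * E * real v + 16 * E * R\<^sup>2 * (real v * \<eta>)"
      by (simp add: algebra_simps)
    ultimately show ?thesis by (simp add: power2_eq_square)
  qed
  finally show ?thesis .
qed

lemma sum_inverse_le_ln: "(\<Sum>k\<in>{1..nat \<lfloor>x\<rfloor>}. 1 / real k) \<le> 1 + ln x" if "x \<ge> 1"
proof -
  have "nat \<lfloor>x\<rfloor> \<noteq> 0" using that by simp
  then obtain n where n: "nat \<lfloor>x\<rfloor> = Suc n" using not0_implies_Suc by blast
  have "harm (Suc n) - ln (real (Suc n)) \<le> harm (Suc 0) - ln (real (Suc 0))"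
    using decseqD[OF decseq_harm_diff_ln, of 0 n] by simp
  then have "harm (Suc n) \<le> 1 + ln (real (Suc n))" by (simp add: harm_def)
  also have "ln (real (Suc n)) \<le> ln x"
  proof -
    have "real (Suc n) \<le> x" using that unfolding n[symmetric] by linarith
    then show ?thesis by (subst ln_le_cancel_iff) auto
  qed
  finally show ?thesis unfolding n harm_def by (simp add: divide_inverse)
qed

lemma sum_inverse_squares_le: "(\<Sum>k\<in>{1..n}. 1 / (real k)\<^sup>2) \<le> 2"
proof -
  \<comment> \<open>The subtracted term makes the induction telescope.\<close>
  have bound: "(\<Sum>k\<in>{1..Suc n}. 1 / (real k)\<^sup>2) \<le> 2 - 1 / real (Suc n)" for n
  proof (induction n)
    case (Suc n)
    have "1 / (real (Suc (Suc n)))\<^sup>2 \<le> 1 / (real (Suc n) * real (Suc (Suc n)))"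
      unfolding power2_eq_square by (intro divide_left_mono mult_right_mono) auto
    also have "\<dots> = 1 / real (Suc n) - 1 / real (Suc (Suc n))" by (simp add: field_simps)
    finally show ?case using Suc by simp
  qed simp
  show ?thesis
  proof (cases n)
    case (Suc k)
    have "0 \<le> 1 / real (Suc k)" by simp
    then show ?thesis using bound[of k] unfolding Suc by linarith
  qed simp
qed

text \<open>The smaller of \<^term>\<open>R\<close> and \<^term>\<open>L\<close> decides from which side the incidences are counted; this
  replaces the product of the two trivial counts by \<^term>\<open>R * L\<close>.\<close>

lemma sum_card_near_pairs_coprime:
  fixes \<alpha> :: real
  assumes "\<alpha> \<noteq> 0"
  shows "\<exists>C>0. \<forall>\<theta> L \<delta> R. 0 \<le> \<theta> \<and> \<theta> \<le> 1 \<and> L \<ge> 1 \<and> 0 \<le> \<delta> \<and> \<delta> \<le> 1 \<and> R > 0 \<longrightarrow>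
    (\<Sum>p\<in>coprime_pairs R. real (card (near_pairs \<alpha> \<theta> L \<delta> (log_ratio p))))
      \<le> C * (R * L + R\<^sup>2 * L\<^sup>2 * \<delta> * (1 + ln L))"
proof -
  define E where "E = exp (1 / \<bar>\<alpha>\<bar>)"
  define e where "e = 6 / \<bar>\<alpha>\<bar> * E"
  \<comment> \<open>The three groups of summands serve, in order, the three cases distinguished
    below.\<close>
  define C where "C = 32 + 8 * e * (2 * E + 1) + (8 + 2 * E + 32 * \<bar>\<alpha>\<bar> * E\<^sup>2 * e)"
  have E1: "E \<ge> 1" by (simp add: E_def)
  have e0: "e > 0" using assms E1 by (simp add: e_def)
  have C0: "C \<ge> 32" "C \<ge> 8 * e * (2 * E + 1)" "C \<ge> 8 + 2 * E" "C \<ge> 32 * \<bar>\<alpha>\<bar> * E\<^sup>2 * e"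
    using E1 e0 by (simp_all add: C_def add_nonneg_nonneg)
  show ?thesis
  proof (intro exI[of _ C] conjI allI impI)
    show "C > 0" using C0 by simp
    fix \<theta> L \<delta> R :: real
    assume "0 \<le> \<theta> \<and> \<theta> \<le> 1 \<and> L \<ge> 1 \<and> 0 \<le> \<delta> \<and> \<delta> \<le> 1 \<and> R > 0"
    then have \<theta>: "0 \<le> \<theta>" "\<theta> \<le> 1" and L: "L \<ge> 1" and \<delta>: "0 \<le> \<delta>" "\<delta> \<le> 1" and R: "R > 0" by auto
    define N where "N p = near_pairs \<alpha> \<theta> L \<delta> (log_ratio p)" for p
    define \<epsilon> where "\<epsilon> = e * L * \<delta>"
    define Y where "Y = R\<^sup>2 * L\<^sup>2 * \<delta>"
    have Y0: "0 \<le> Y" using \<delta> by (simp add: Y_def)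
    have RL0: "0 \<le> R * L" using R L by simp
    have \<epsilon>0: "0 \<le> \<epsilon>" using e0 L \<delta> by (simp add: \<epsilon>_def)
    have lnL: "0 \<le> ln L" using L by simp
    have YY: "Y \<le> Y * (1 + ln L)" using Y0 lnL by (simp add: mult_le_cancel_left1)
    have cP: "real (card (coprime_pairs R)) \<le> 4 * R\<^sup>2" using card_coprime_pairs_le R by simp
    have goal: "(\<Sum>p\<in>coprime_pairs R. real (card (N p))) \<le> C * (R * L + Y * (1 + ln L))"
    proof -
      \<comment> \<open>For \<open>L \<le> R\<close> the sum is reorganised over the pairs
        \<open>(l, m)\<close>, and \<open>L * L\<close> is absorbed by \<open>R * L\<close>. If
        \<open>\<epsilon>\<close> is bounded below, the crude count is enough. Otherwise
        \<open>\<epsilon>\<close> is small enough for the rational approximation argument.\<close>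
      consider "L \<le> R" | "\<epsilon> > 1 / (2 * E)" | "R < L" "\<epsilon> \<le> 1 / (2 * E)" by linarith
      then show ?thesis
      proof cases
        case 1
        define Z where "Z = dyadic L \<times> dyadic L"
        define y where "y z = - \<alpha> * (ln (real (fst z) + \<theta>) - ln (real (snd z) + \<theta>))" for z :: "nat \<times> nat"
        have finZ: "finite Z" by (simp add: Z_def finite_dyadic)
        have "N p = {z \<in> Z. \<bar>log_ratio p - y z\<bar> \<le> \<delta>}" for p
          by (auto simp: N_def near_pairs_def Z_def y_def)
        then have "(\<Sum>p\<in>coprime_pairs R. card (N p)) =
            (\<Sum>p\<in>coprime_pairs R. \<Sum>z\<in>Z. of_bool (\<bar>log_ratio p - y z\<bar> \<le> \<delta>))"
          using finZ by (simp add: sum_of_bool_eq Int_def)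
        also have "\<dots> = (\<Sum>z\<in>Z. \<Sum>p\<in>coprime_pairs R. of_bool (\<bar>log_ratio p - y z\<bar> \<le> \<delta>))"
          by (rule sum.swap)
        also have "\<dots> = (\<Sum>z\<in>Z. card {p \<in> coprime_pairs R. \<bar>log_ratio p - y z\<bar> \<le> \<delta>})"
          by (simp add: sum_of_bool_eq Int_def finite_coprime_pairs)
        finally have "(\<Sum>p\<in>coprime_pairs R. real (card (N p))) =
            (\<Sum>z\<in>Z. real (card {p \<in> coprime_pairs R. \<bar>log_ratio p - y z\<bar> \<le> \<delta>}))"
          by (simp flip: of_nat_sum)
        also have "\<dots> \<le> (\<Sum>z\<in>Z. 1 + 8 * R\<^sup>2 * \<delta>)"
          using R \<delta> by (intro sum_mono card_log_ratio_near)
        also have "\<dots> = (real (card (dyadic L)))\<^sup>2 * (1 + 8 * R\<^sup>2 * \<delta>)"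
          by (simp add: Z_def card_cartesian_product power2_eq_square)
        also have "\<dots> \<le> (2 * L)\<^sup>2 * (1 + 8 * R\<^sup>2 * \<delta>)"
          using card_dyadic_le[of L] L \<delta> by (intro mult_right_mono power_mono) auto
        also have "\<dots> = 4 * (L * L) + 32 * Y" by (simp add: Y_def algebra_simps power2_eq_square)
        also have "\<dots> \<le> 32 * (R * L) + 32 * (Y * (1 + ln L))"
        proof -
          have "L * L \<le> R * L" using 1 L by (intro mult_right_mono) auto
          then show ?thesis using YY RL0 by linarith
        qed
        also have "\<dots> \<le> C * (R * L) + C * (Y * (1 + ln L))"
          using C0(1) RL0 Y0 YY by (intro add_mono mult_right_mono) auto
        finally show ?thesis by (simp add: distrib_left)
      next
        case 2
        \<comment> \<open>The 1 in \<open>1 + \<epsilon>\<close> is absorbed by a multiple of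
          \<open>\<epsilon>\<close>, so the trivial count becomes a multiple of
          \<open>Y\<close>.\<close>
        have eE: "1 \<le> 2 * E * \<epsilon>" using 2 E1 by (simp add: field_simps)
        have "real (card (N p)) \<le> 2 * L * (1 + \<epsilon>)" for p
          using card_near_pairs_crude[OF assms \<theta> L \<delta>] unfolding N_def \<epsilon>_def e_def E_def by (simp add: mult.assoc)
        then have "(\<Sum>p\<in>coprime_pairs R. real (card (N p))) \<le> real (card (coprime_pairs R)) * (2 * L * (1 + \<epsilon>))"
          by (rule sum_bounded_above)
        also have "\<dots> \<le> 4 * R\<^sup>2 * (2 * L * (2 * E * \<epsilon> + \<epsilon>))"
          using cP eE L \<epsilon>0 by (intro mult_mono) auto
        also have "\<dots> = 8 * e * (2 * E + 1) * Y"
          by (simp add: Y_def \<epsilon>_def power2_eq_square algebra_simps)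
        also have "\<dots> \<le> C * Y" using C0(2) Y0 by (rule mult_right_mono)
        also have "\<dots> \<le> C * (R * L + Y * (1 + ln L))"
          using C0(1) YY RL0 by (intro mult_left_mono) auto
        finally show ?thesis .
      next
        case 3
        define app where "app p v \<longleftrightarrow> (\<exists>u::int. \<bar>of_int u - exp (- log_ratio p / \<alpha>) * real v\<bar> \<le> \<epsilon>)" for p and v :: nat
        have "1 / (2 * E) < 1" using E1 by simp
        then have \<epsilon>1: "\<epsilon> < 1" using 3 by linarith
        have "real (card (N p)) \<le> 1 + L / R + (\<Sum>v\<in>below R. L / real v * of_bool (app p v))" for p
          using card_near_pairs_gap[OF assms \<theta> L \<delta> R] \<epsilon>1 unfolding N_def \<epsilon>_def e_def E_def app_def by simp
        then have "(\<Sum>p\<in>coprime_pairs R. real (card (N p))) \<le>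
            (\<Sum>p\<in>coprime_pairs R. 1 + L / R + (\<Sum>v\<in>below R. L / real v * of_bool (app p v)))"
          by (rule sum_mono)
        also have "\<dots> = real (card (coprime_pairs R)) * (1 + L / R) +
            (\<Sum>p\<in>coprime_pairs R. \<Sum>v\<in>below R. L / real v * of_bool (app p v))"
          by (simp only: sum.distrib) (simp add: algebra_simps)
        also have "(\<Sum>p\<in>coprime_pairs R. \<Sum>v\<in>below R. L / real v * of_bool (app p v)) =
            (\<Sum>v\<in>below R. L / real v * real (card {p \<in> coprime_pairs R. app p v}))"
          by (subst sum.swap, intro sum.cong refl, subst sum_distrib_left[symmetric])
             (simp add: sum_of_bool_eq Int_def finite_coprime_pairs)
        \<comment> \<open>The weight \<open>L / v\<close> cancels the \<open>v\<close> in the first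
          term, which yields \<open>R * L\<close> without a logarithm; the second term keeps
          \<open>1 / v\<close> and yields a harmonic sum.\<close>
        also have "\<dots> \<le> (\<Sum>v\<in>below R. L / real v * (2 * E * real v + 32 * \<bar>\<alpha>\<bar> * E\<^sup>2 * R\<^sup>2 * \<epsilon>))"
        proof (intro sum_mono mult_left_mono)
          fix v assume "v \<in> below R"
          then have "v \<ge> 1" by (simp add: below_def)
          from card_approximable_le[OF assms R this \<epsilon>0] 3(2)
          show "real (card {p \<in> coprime_pairs R. app p v}) \<le> 2 * E * real v + 32 * \<bar>\<alpha>\<bar> * E\<^sup>2 * R\<^sup>2 * \<epsilon>"
            unfolding app_def E_def by simp
        qed (use L in auto)
        also have "\<dots> = (\<Sum>v\<in>below R. 2 * E * L + 32 * \<bar>\<alpha>\<bar> * E\<^sup>2 * e * Y * (1 / real v))"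
          by (intro sum.cong refl) (auto simp: below_def \<epsilon>_def Y_def power2_eq_square field_simps)
        also have "\<dots> = 2 * E * L * real (card (below R)) + 32 * \<bar>\<alpha>\<bar> * E\<^sup>2 * e * Y * (\<Sum>v\<in>below R. 1 / real v)"
          by (simp add: sum.distrib sum_distrib_left)
        also have "\<dots> \<le> 2 * E * L * R + 32 * \<bar>\<alpha>\<bar> * E\<^sup>2 * e * Y * (1 + ln L)"
        proof (intro add_mono mult_left_mono)
          have "card (below R) \<le> nat \<lfloor>R\<rfloor>" using card_mono[OF _ below_subset[of R]] by simp
          then show "real (card (below R)) \<le> R" using R by linarith
          \<comment> \<open>The harmonic sum is extended from \<open>R\<close> to \<open>L\<close>:
            the logarithmic bound requires an argument of at least 1, and \<open>R\<close> may be
            smaller.\<close>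
          have "below R \<subseteq> {1..nat \<lfloor>L\<rfloor>}" using below_subset[of L] 3(1) by (auto simp: below_def)
          then have "(\<Sum>v\<in>below R. 1 / real v) \<le> (\<Sum>v\<in>{1..nat \<lfloor>L\<rfloor>}. 1 / real v)"
            by (intro sum_mono2) auto
          also have "\<dots> \<le> 1 + ln L" by (rule sum_inverse_le_ln[OF L])
          finally show "(\<Sum>v\<in>below R. 1 / real v) \<le> 1 + ln L" .
        qed (use E1 e0 L Y0 in auto)
        finally have "(\<Sum>p\<in>coprime_pairs R. real (card (N p))) \<le> real (card (coprime_pairs R)) * (1 + L / R) +
            (2 * E * L * R + 32 * \<bar>\<alpha>\<bar> * E\<^sup>2 * e * Y * (1 + ln L))" by simp
        also have "real (card (coprime_pairs R)) * (1 + L / R) \<le> 4 * R\<^sup>2 * (1 + L / R)"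
          using cP R L by (intro mult_right_mono) auto
        also have "4 * R\<^sup>2 * (1 + L / R) = 4 * (R * R) + 4 * (R * L)"
          using R by (simp add: field_simps power2_eq_square)
        also have "R * R \<le> R * L" using R 3(1) by (intro mult_left_mono) auto
        finally have "(\<Sum>p\<in>coprime_pairs R. real (card (N p))) \<le>
            (8 + 2 * E) * (R * L) + 32 * \<bar>\<alpha>\<bar> * E\<^sup>2 * e * (Y * (1 + ln L))"
          by (simp add: algebra_simps)
        also have "\<dots> \<le> C * (R * L) + C * (Y * (1 + ln L))"
          using C0 RL0 Y0 YY by (intro add_mono mult_right_mono) auto
        finally show ?thesis by (simp add: distrib_left)
      qed
    qed
    then show "(\<Sum>p\<in>coprime_pairs R. real (card (near_pairs \<alpha> \<theta> L \<delta> (log_ratio p))))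
      \<le> C * (R * L + R\<^sup>2 * L\<^sup>2 * \<delta> * (1 + ln L))" by (simp add: N_def Y_def)
  qed
qed

section \<open>From reduced pairs to all quadruples\<close>

text \<open>Dividing both components by their gcd \<open>g\<close> preserves
  \<open>log_ratio\<close> and scales the range to \<open>K / g\<close>. The cutoff for
  \<open>g\<close> loses nothing, since a gcd is at most either component.\<close>

lemma sum_pairs_by_gcd:
  fixes f :: "real \<Rightarrow> real"
  assumes "K \<ge> 0"
  shows "(\<Sum>p\<in>dyadic K \<times> dyadic K. f (log_ratio p)) =
    (\<Sum>g\<in>{1..nat \<lfloor>2 * K\<rfloor>}. \<Sum>p\<in>coprime_pairs (K / real g). f (log_ratio p))"
proof -
  let ?n = "nat \<lfloor>2 * K\<rfloor>"
  have "(\<Sum>p\<in>dyadic K \<times> dyadic K. f (log_ratio p)) =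
      (\<Sum>(g, p)\<in>Sigma {1..?n} (\<lambda>g. coprime_pairs (K / real g)). f (log_ratio p))"
  proof (rule sum.reindex_bij_witness[where
        i = "\<lambda>(g, (r, s)). (g * r, g * s)" and j = "\<lambda>(k, l). (gcd k l, (k div gcd k l, l div gcd k l))"])
    fix a assume a: "a \<in> dyadic K \<times> dyadic K"
    obtain k l where kl: "a = (k, l)" by fastforce
    have b: "K < k" "k \<le> 2 * K" "K < l" "l \<le> 2 * K" using a by (auto simp: kl dyadic_def)
    then have pos: "k > 0" "l > 0" using assms by (auto intro: gr0I)
    define g where "g = gcd k l"
    have g: "g > 0" "g dvd k" "g dvd l" using pos by (auto simp: g_def)
    obtain r s where rs: "k = g * r" "l = g * s" using g by (auto elim!: dvdE)
    have rs': "k div g = r" "l div g = s" using rs g(1) by simp_all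
    have cop: "coprime r s" using div_gcd_coprime[of k l] pos unfolding g_def[symmetric] rs' by simp
    have pos': "r > 0" "s > 0" using pos rs by (auto intro: gr0I)
    show "(\<lambda>(g, (r, s)). (g * r, g * s)) ((\<lambda>(k, l). (gcd k l, (k div gcd k l, l div gcd k l))) a) = a"
      by (simp add: kl)
    have "g \<le> k" using g pos dvd_imp_le by blast
    then have "g \<in> {1..?n}" using b g by (simp add: le_nat_floor)
    moreover have "(r, s) \<in> coprime_pairs (K / real g)"
      using b g(1) cop unfolding coprime_pairs_def dyadic_def rs by (simp add: field_simps)
    ultimately show "(\<lambda>(k, l). (gcd k l, (k div gcd k l, l div gcd k l))) a \<in> Sigma {1..?n} (\<lambda>g. coprime_pairs (K / real g))"
      by (simp add: kl rs' flip: g_def)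
    have "log_ratio (k, l) = log_ratio (r, s)"
      using g(1) pos' by (simp add: log_ratio_def rs ln_mult)
    then show "(case (\<lambda>(k, l). (gcd k l, (k div gcd k l, l div gcd k l))) a of (g, p) \<Rightarrow> f (log_ratio p)) = f (log_ratio a)"
      by (simp add: kl rs' flip: g_def)
  next
    fix b assume "b \<in> Sigma {1..?n} (\<lambda>g. coprime_pairs (K / real g))"
    then obtain g r s where b: "b = (g, (r, s))" and g: "g \<ge> 1" and rs: "(r, s) \<in> coprime_pairs (K / real g)"
      by auto
    have cop: "coprime r s" using rs by (simp add: coprime_pairs_def)
    show "(\<lambda>(k, l). (gcd k l, (k div gcd k l, l div gcd k l))) ((\<lambda>(g, (r, s)). (g * r, g * s)) b) = b"
      using cop g by (simp add: b gcd_mult_distrib_nat[symmetric])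
    show "(\<lambda>(g, (r, s)). (g * r, g * s)) b \<in> dyadic K \<times> dyadic K"
      using rs g by (auto simp: b coprime_pairs_def dyadic_def field_simps)
  qed
  then show ?thesis by (simp add: sum.Sigma finite_coprime_pairs)
qed

text \<open>The frequency in \<open>t\<close> of the product of \<open>cpow_it k t\<close> and
  \<open>cpow_it (l + \<theta>) (\<alpha> * t)\<close>, for \<open>n = (k, l)\<close>.\<close>

definition log_freq :: "real \<Rightarrow> real \<Rightarrow> nat \<times> nat \<Rightarrow> real" where
  "log_freq \<alpha> \<theta> n = ln (real (fst n)) + \<alpha> * ln (real (snd n) + \<theta>)"

text \<open>Regroup each quadruple as \<open>(k, k')\<close> and \<open>(l, l')\<close> and apply
  the bound for reduced pairs with \<open>R = K / g\<close>. Summation over \<open>g\<close> is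
  harmonic in the term linear in \<open>R\<close> and convergent in the quadratic one.\<close>

lemma card_close_freqs_le:
  fixes \<alpha> :: real
  assumes "\<alpha> \<noteq> 0"
  shows "\<exists>C>0. \<forall>\<theta> K L \<delta>. 0 \<le> \<theta> \<and> \<theta> \<le> 1 \<and> K \<ge> 1 \<and> L \<ge> 1 \<and> 0 \<le> \<delta> \<and> \<delta> \<le> 1 \<longrightarrow>
    real (card {(m, n). m \<in> dyadic K \<times> dyadic L \<and> n \<in> dyadic K \<times> dyadic L \<and>
        \<bar>log_freq \<alpha> \<theta> m - log_freq \<alpha> \<theta> n\<bar> \<le> \<delta>})
      \<le> C * (K * L * (1 + ln (2 * K)) + 2 * K\<^sup>2 * L\<^sup>2 * \<delta> * (1 + ln L))"
proof -
  obtain C where C: "C > 0" and main: "\<forall>\<theta> L \<delta> R. 0 \<le> \<theta> \<and> \<theta> \<le> 1 \<and> L \<ge> 1 \<and> 0 \<le> \<delta> \<and> \<delta> \<le> 1 \<and> R > 0 \<longrightarrow>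
    (\<Sum>p\<in>coprime_pairs R. real (card (near_pairs \<alpha> \<theta> L \<delta> (log_ratio p))))
      \<le> C * (R * L + R\<^sup>2 * L\<^sup>2 * \<delta> * (1 + ln L))"
    using sum_card_near_pairs_coprime[OF assms] by blast
  show ?thesis
  proof (intro exI[of _ C] conjI allI impI C)
    fix \<theta> K L \<delta> :: real
    assume "0 \<le> \<theta> \<and> \<theta> \<le> 1 \<and> K \<ge> 1 \<and> L \<ge> 1 \<and> 0 \<le> \<delta> \<and> \<delta> \<le> 1"
    then have h: "0 \<le> \<theta>" "\<theta> \<le> 1" "L \<ge> 1" "0 \<le> \<delta>" "\<delta> \<le> 1" and K: "K \<ge> 1" by auto
    define Q where "Q = {(m, n). m \<in> dyadic K \<times> dyadic L \<and> n \<in> dyadic K \<times> dyadic L \<and>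
        \<bar>log_freq \<alpha> \<theta> m - log_freq \<alpha> \<theta> n\<bar> \<le> \<delta>}"
    define N where "N p = near_pairs \<alpha> \<theta> L \<delta> (log_ratio p)" for p
    let ?n = "nat \<lfloor>2 * K\<rfloor>"
    have "card Q \<le> card (Sigma (dyadic K \<times> dyadic K) N)"
    proof (rule card_inj_on_le[where f = "\<lambda>((k, l), (k', l')). ((k, k'), (l, l'))"])
      show "(\<lambda>((k, l), (k', l')). ((k, k'), (l, l'))) ` Q \<subseteq> Sigma (dyadic K \<times> dyadic K) N"
        by (auto simp: Q_def N_def near_pairs_def log_freq_def log_ratio_def algebra_simps)
    qed (auto simp: inj_on_def N_def finite_near_pairs finite_dyadic intro!: finite_SigmaI)
    also have "\<dots> = (\<Sum>p\<in>dyadic K \<times> dyadic K. card (N p))"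
      by (rule card_SigmaI) (auto simp: N_def finite_near_pairs finite_dyadic)
    finally have "real (card Q) \<le> (\<Sum>p\<in>dyadic K \<times> dyadic K. real (card (near_pairs \<alpha> \<theta> L \<delta> (log_ratio p))))"
      by (simp add: N_def flip: of_nat_sum)
    also have "\<dots> = (\<Sum>g\<in>{1..?n}. \<Sum>p\<in>coprime_pairs (K / real g). real (card (near_pairs \<alpha> \<theta> L \<delta> (log_ratio p))))"
      using K by (intro sum_pairs_by_gcd) auto
    also have "\<dots> \<le> (\<Sum>g\<in>{1..?n}. C * (K / real g * L + (K / real g)\<^sup>2 * L\<^sup>2 * \<delta> * (1 + ln L)))"
      using K h by (intro sum_mono main[rule_format]) auto
    also have "\<dots> = C * (K * L * (\<Sum>g\<in>{1..?n}. 1 / real g) +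
        K\<^sup>2 * L\<^sup>2 * \<delta> * (1 + ln L) * (\<Sum>g\<in>{1..?n}. 1 / (real g)\<^sup>2))"
      by (simp add: sum_distrib_left power_divide mult_ac flip: sum.distrib)
    also have "\<dots> \<le> C * (K * L * (1 + ln (2 * K)) + K\<^sup>2 * L\<^sup>2 * \<delta> * (1 + ln L) * 2)"
      using C K h by (intro mult_left_mono add_mono sum_inverse_squares_le sum_inverse_le_ln) auto
    finally show "real (card Q) \<le> C * (K * L * (1 + ln (2 * K)) + 2 * K\<^sup>2 * L\<^sup>2 * \<delta> * (1 + ln L))"
      by (simp add: mult_ac)
  qed
qed

section \<open>The mean value estimate\<close>

lemma cpow_it_eq_cis: "cpow_it x t = cis (ln x * t)"
  by (simp add: cpow_it_def cis_conv_exp mult.commute)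

lemma norm_cpow_it [simp]: "norm (cpow_it x t) = 1"
  by (simp add: cpow_it_eq_cis)

lemma norm_dyadic_sum_le:
  assumes "\<forall>k\<in>dyadic K. norm (a k) \<le> A" "K \<ge> 0" "\<And>k. norm (z k) = 1"
  shows "(norm (\<Sum>k\<in>dyadic K. a k * z k :: complex))\<^sup>2 \<le> 4 * K\<^sup>2 * A\<^sup>2"
proof -
  \<comment> \<open>The absolute value is taken because an empty range leaves the sign of
    \<open>A\<close> free.\<close>
  have "norm (\<Sum>k\<in>dyadic K. a k * z k) \<le> (\<Sum>k\<in>dyadic K. \<bar>A\<bar>)"
    using assms by (intro sum_norm_le) (auto simp: norm_mult intro: order_trans)
  also have "\<dots> \<le> 2 * K * \<bar>A\<bar>" using card_dyadic_le[OF assms(2)] by (simp add: mult_right_mono)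
  finally have "(norm (\<Sum>k\<in>dyadic K. a k * z k))\<^sup>2 \<le> (2 * K * \<bar>A\<bar>)\<^sup>2" by (intro power_mono) auto
  then show ?thesis by (simp add: power_mult_distrib)
qed

text \<open>The maximum with 1 keeps the logarithmic factor meaningful when
  \<open>2 * K * L * T\<close> is small and its logarithm drops below 1 or becomes negative. The
  constant is chosen before everything except \<open>\<alpha>\<close>.\<close>

theorem theorem4:
  fixes \<alpha> :: real
  assumes "\<alpha> \<noteq> 0"
  shows "\<exists>C>0. \<forall>(\<theta>::real) (T::real) (K::real) (L::real) (a::nat \<Rightarrow> complex) (b::nat \<Rightarrow> complex) (A::real) (B::real).
      0 \<le> \<theta> \<and> \<theta> < 1 \<and> T > 0 \<and> K \<ge> 1 \<and> L \<ge> 1 \<and> (\<theta> \<noteq> 0 \<longrightarrow> L \<le> sqrt T) \<and>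
      (\<forall>k\<in>dyadic K. norm (a k) \<le> A) \<and> (\<forall>l\<in>dyadic L. norm (b l) \<le> B) \<longrightarrow>
      (let I = integral {0..T} (\<lambda>t.
                 (norm (\<Sum>k\<in>dyadic K. a k * cpow_it (real k) t))\<^sup>2 *
                 (norm (\<Sum>l\<in>dyadic L. b l * cpow_it (real l + \<theta>) (\<alpha> * t)))\<^sup>2)
       in I \<le> C * A\<^sup>2 * B\<^sup>2 * (T + K * L) * (K * L) * (max 1 (ln (2 * K * L * T))) ^ 3 \<and>
          (\<theta> = 0 \<longrightarrow> I \<le> C * A\<^sup>2 * B\<^sup>2 * (T + K * L) * (K * L) * (max 1 (ln (2 * K * L * T))) ^ 2))"
proof -
  obtain C1 where C1: "C1 > 0" and count: "\<forall>\<theta> K L \<delta>. 0 \<le> \<theta> \<and> \<theta> \<le> 1 \<and> K \<ge> 1 \<and> L \<ge> 1 \<and> 0 \<le> \<delta> \<and> \<delta> \<le> 1 \<longrightarrow>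
    real (card {(m, n). m \<in> dyadic K \<times> dyadic L \<and> n \<in> dyadic K \<times> dyadic L \<and>
        \<bar>log_freq \<alpha> \<theta> m - log_freq \<alpha> \<theta> n\<bar> \<le> \<delta>})
      \<le> C1 * (K * L * (1 + ln (2 * K)) + 2 * K\<^sup>2 * L\<^sup>2 * \<delta> * (1 + ln L))"
    using card_close_freqs_le[OF assms] by blast
  define C0 where "C0 = 4 * pi * (exp 1)\<^sup>2"
  have C0: "C0 > 0" by (simp add: C0_def)
  \<comment> \<open>The 16 serves \<open>T < 1\<close>, the other summand
    \<open>T \<ge> 1\<close>.\<close>
  define C where "C = 16 + 4 * C0 * C1"
  have C: "C \<ge> 16" "C \<ge> 4 * C0 * C1" using C0 C1 by (simp_all add: C_def)
  show ?thesis
  proof (intro exI[of _ C] conjI allI impI)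
    show "C > 0" using C by simp
    fix \<theta> T K L :: real and a b :: "nat \<Rightarrow> complex" and A B :: real
    assume hyp: "0 \<le> \<theta> \<and> \<theta> < 1 \<and> T > 0 \<and> K \<ge> 1 \<and> L \<ge> 1 \<and> (\<theta> \<noteq> 0 \<longrightarrow> L \<le> sqrt T) \<and>
      (\<forall>k\<in>dyadic K. norm (a k) \<le> A) \<and> (\<forall>l\<in>dyadic L. norm (b l) \<le> B)"
    then have \<theta>: "0 \<le> \<theta>" "\<theta> \<le> 1" and T: "T > 0" and K: "K \<ge> 1" and L: "L \<ge> 1"
      and aA: "\<forall>k\<in>dyadic K. norm (a k) \<le> A" and bB: "\<forall>l\<in>dyadic L. norm (b l) \<le> B" by auto
    define f where "f t = (norm (\<Sum>k\<in>dyadic K. a k * cpow_it (real k) t))\<^sup>2 *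
      (norm (\<Sum>l\<in>dyadic L. b l * cpow_it (real l + \<theta>) (\<alpha> * t)))\<^sup>2" for t
    define m where "m = max 1 (ln (2 * K * L * T))"
    define X where "X = A\<^sup>2 * B\<^sup>2 * (T + K * L) * (K * L)"
    have m1: "m \<ge> 1" by (simp add: m_def)
    have KL: "0 < K * L" using K L by simp
    have X0: "0 \<le> X" using T KL by (simp add: X_def)
    have fint: "f integrable_on {0..T}"
      unfolding f_def cpow_it_eq_cis by (intro integrable_continuous_real continuous_intros)
    \<comment> \<open>A single power of \<open>m\<close> is proved; as \<open>m \<ge> 1\<close>,
      both required powers follow.\<close>
    have main: "integral {0..T} f \<le> C * X * m"
    proof (cases "T < 1")
      \<comment> \<open>The count is available only for \<open>1 / T \<le> 1\<close>; a short
        interval is handled by the trivial bound for both sums.\<close>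
      case True
      have "f t \<le> (4 * K\<^sup>2 * A\<^sup>2) * (4 * L\<^sup>2 * B\<^sup>2)" for t
        unfolding f_def using aA bB K L by (intro mult_mono norm_dyadic_sum_le) auto
      then have "integral {0..T} f \<le> integral {0..T} (\<lambda>t. (4 * K\<^sup>2 * A\<^sup>2) * (4 * L\<^sup>2 * B\<^sup>2))"
        by (intro integral_le fint) auto
      also have "\<dots> = T * (16 * (A\<^sup>2 * B\<^sup>2 * (K * L) * (K * L)))"
        using T by (simp add: power2_eq_square mult_ac)
      also have "\<dots> \<le> 1 * (16 * (A\<^sup>2 * B\<^sup>2 * (K * L) * (K * L)))"
        using True KL by (intro mult_right_mono) auto
      also have "\<dots> \<le> 16 * X"
        using T KL unfolding X_def by (auto intro!: mult_right_mono mult_left_mono)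
      also have "\<dots> \<le> C * X" using C X0 by (intro mult_right_mono) auto
      also have "\<dots> \<le> C * X * m" using C X0 m1 mult_left_mono[of 1 m "C * X"] by simp
      finally show ?thesis .
    next
      case False
      then have T1: "T \<ge> 1" by simp
      define c where "c n = a (fst n) * b (snd n)" for n
      have f_eq: "f t = (norm (\<Sum>n\<in>dyadic K \<times> dyadic L. c n * cis (log_freq \<alpha> \<theta> n * t)))\<^sup>2" for t
      proof -
        have "(\<Sum>k\<in>dyadic K. a k * cpow_it (real k) t) * (\<Sum>l\<in>dyadic L. b l * cpow_it (real l + \<theta>) (\<alpha> * t)) =
            (\<Sum>k\<in>dyadic K. \<Sum>l\<in>dyadic L. c (k, l) * cis (log_freq \<alpha> \<theta> (k, l) * t))"
          unfolding sum_product
          by (intro sum.cong refl)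
             (simp add: c_def log_freq_def cpow_it_eq_cis cis_mult distrib_left mult_ac)
        also have "\<dots> = (\<Sum>n\<in>dyadic K \<times> dyadic L. c n * cis (log_freq \<alpha> \<theta> n * t))"
          by (simp add: sum.cartesian_product)
        finally show ?thesis unfolding f_def power_mult_distrib[symmetric] norm_mult[symmetric] by simp
      qed
      have cM: "norm (c n) \<le> A * B" if "n \<in> dyadic K \<times> dyadic L" for n
      proof -
        have "norm (a (fst n)) \<le> A" "norm (b (snd n)) \<le> B" using that aA bB by auto
        then show ?thesis unfolding c_def norm_mult
          by (intro mult_mono) (auto intro: order_trans[OF norm_ge_zero])
      qed
      \<comment> \<open>Since \<open>T \<ge> 1\<close>, both \<open>2 * K\<close> and
        \<open>L\<close> are at most \<open>2 * K * L * T\<close>, so each logarithm in the count is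
        bounded through \<open>m\<close>.\<close>
      have "K * 1 \<le> K * (L * T)" using K L T1 mult_mono[of 1 L 1 T] by (intro mult_left_mono) auto
      then have "2 * K \<le> 2 * K * L * T" by (simp add: mult.assoc)
      then have "ln (2 * K) \<le> ln (2 * K * L * T)" using K L T by (subst ln_le_cancel_iff) auto
      then have lnK: "1 + ln (2 * K) \<le> 2 * m" unfolding m_def by linarith
      have "1 * L \<le> (2 * K * T) * L"
        using K L T1 mult_mono[of 1 K 1 T] by (intro mult_right_mono) auto
      then have "L \<le> 2 * K * L * T" by (simp add: mult_ac)
      then have "ln L \<le> ln (2 * K * L * T)" using K L T by (subst ln_le_cancel_iff) auto
      then have lnL: "1 + ln L \<le> 2 * m" unfolding m_def by linarith
      have "integral {0..T} f \<le> C0 * T * (A * B)\<^sup>2 *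
          real (card {(m, n). m \<in> dyadic K \<times> dyadic L \<and> n \<in> dyadic K \<times> dyadic L \<and>
            \<bar>log_freq \<alpha> \<theta> m - log_freq \<alpha> \<theta> n\<bar> \<le> 1 / T})"
        unfolding f_eq C0_def using T cM by (intro exp_sum_mean_square) (auto simp: finite_dyadic)
      also have "\<dots> \<le> C0 * T * (A * B)\<^sup>2 *
          (C1 * (K * L * (1 + ln (2 * K)) + 2 * K\<^sup>2 * L\<^sup>2 * (1 / T) * (1 + ln L)))"
        using C0 T T1 \<theta> K L by (intro mult_left_mono count[rule_format]) auto
      also have "\<dots> \<le> C0 * T * (A * B)\<^sup>2 *
          (C1 * (K * L * (2 * m) + 2 * K\<^sup>2 * L\<^sup>2 * (1 / T) * (2 * m)))"
        using C0 C1 T lnK lnL KL by (intro mult_left_mono add_mono) auto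
      also have "\<dots> = C0 * C1 * (A * B)\<^sup>2 * m * (K * L) * (2 * T + 4 * (K * L))"
        using T by (simp add: field_simps power2_eq_square)
      also have "\<dots> \<le> C0 * C1 * (A * B)\<^sup>2 * m * (K * L) * (4 * (T + K * L))"
        using C0 C1 T KL m1 by (intro mult_left_mono) auto
      also have "\<dots> = 4 * C0 * C1 * (X * m)" by (simp add: X_def power_mult_distrib mult_ac)
      also have "\<dots> \<le> C * (X * m)" using C X0 m1 by (intro mult_right_mono) auto
      finally show ?thesis by (simp add: mult.assoc)
    qed
    have pow: "integral {0..T} f \<le> C * A\<^sup>2 * B\<^sup>2 * (T + K * L) * (K * L) * m ^ p" if "p \<ge> 1" for p
    proof -
      have "C * X * m \<le> C * X * m ^ p"
        using C X0 m1 that power_increasing[of 1 p m] by (intro mult_left_mono) auto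
      then show ?thesis using main by (simp add: X_def mult.assoc)
    qed
    show "let I = integral {0..T} (\<lambda>t.
                 (norm (\<Sum>k\<in>dyadic K. a k * cpow_it (real k) t))\<^sup>2 *
                 (norm (\<Sum>l\<in>dyadic L. b l * cpow_it (real l + \<theta>) (\<alpha> * t)))\<^sup>2)
       in I \<le> C * A\<^sup>2 * B\<^sup>2 * (T + K * L) * (K * L) * (max 1 (ln (2 * K * L * T))) ^ 3 \<and>
          (\<theta> = 0 \<longrightarrow> I \<le> C * A\<^sup>2 * B\<^sup>2 * (T + K * L) * (K * L) * (max 1 (ln (2 * K * L * T))) ^ 2)"
      unfolding Let_def f_def[symmetric] m_def[symmetric] by (intro conjI impI pow) simp_all
  qed
qed

end
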